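(* Let $(M,\phi,\xi,\eta,g)$ be a $(2n+1)$-dimensional Kenmotsu manifold, let $a>0$ be a constant, and let $(\overline{\phi},\overline{\xi},\overline{\eta},\overline{g})$ be the $D$-homothetically deformed structure on $M$. Then for all vector fields $X,Y$ on $M$: $$(\overline{\nabla}_X\overline{\phi})Y=\frac{1}{a}g(\phi X,Y)\xi-\eta(Y)\phi X,$$ $$\overline{\nabla}\overline{\xi}=\frac{1}{a}(I-\eta\otimes \xi),$$ $$\mathcal{L}_{\overline{\xi}}\overline{g}=2(g-\eta\otimes \eta),$$ $$\overline{\mathrm{div}}(\overline{\xi})=\frac{2n}{a}.$$ Moreover, for any $f\in C^{\infty}(M)$, the Hessian, the gradient, the divergence and the Laplace operators with respect to $\overline{g}$ satisfy: $$\overline{\mathrm{Hess}}(f)=\mathrm{Hess}(f)-\frac{a-1}{a}\xi(f)(g-\eta\otimes \eta),$$ $$\overline{\mathrm{grad}}(f)=\frac{1}{a}\mathrm{grad}(f)-\frac{a-1}{a^2}\xi(f)\xi,$$ $$\overline{\mathrm{div}}=\mathrm{div},$$ $$\overline{\Delta}(f)=\frac{1}{a}\Delta(f)-\frac{2n(a-1)}{a^2}\xi(f)-\frac{a-1}{a^2}\xi(\xi(f)).$$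
   Context: An almost contact metric manifold $(M,\phi,\xi,\eta,g)$ is an odd-dimensional Riemannian manifold $(M,g)$, here of dimension $2n+1$ with $n\ge 1$, together with a $(1,1)$-tensor field $\phi$, a vector field $\xi$ (the Reeb vector field) and a $1$-form $\eta$ such that $\phi^2=-I+\eta\otimes\xi$, $\eta(\xi)=1$, $\eta=g(\xi,\cdot)$ and $g(\phi X,\phi Y)=g(X,Y)-\eta(X)\eta(Y)$. It is a Kenmotsu manifold if the Levi-Civita connection $\nabla$ of $g$ satisfies $(\nabla_X\phi)Y=g(\phi X,Y)\xi-\eta(Y)\phi X$ for all vector fields $X,Y$. For a constant $a>0$, the $D$-homothetically deformed structure is $\overline{\phi}=\phi$, $\overline{\xi}=\frac{1}{a}\xi$, $\overline{\eta}=a\eta$, $\overline{g}=ag+a(a-1)\eta\otimes\eta$. Unbarred $\nabla,\mathrm{Hess},\mathrm{grad},\mathrm{div},\Delta$ are the Levi-Civita connection, Hessian, gradient, divergence and Laplace operator ($\Delta=\mathrm{div}\circ\mathrm{grad}$, the trace of the Hessian) of $g$; barred ones are those of $\overline{g}$. $\mathcal{L}$ denotes the Lie derivative and $\overline{\nabla}\overline{\xi}$ is the endomorphism field $X\mapsto\overline{\nabla}_X\overline{\xi}$. *)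

theory Defs
  imports "HOL-Analysis.Analysis" "HOL-Library.Function_Algebras"
begin

text \<open>
  Functions into a real vector space form a real vector space pointwise. Tangent vectors below are
  operators \<open>('p \<Rightarrow> real) \<Rightarrow> real\<close>, and vector fields are functions from points to tangent vectors,
  so both inherit their linear structure from this instance.
\<close>

instantiation "fun" :: (type, real_vector) real_vector
begin

definition scaleR_fun :: "real \<Rightarrow> ('a \<Rightarrow> 'b) \<Rightarrow> 'a \<Rightarrow> 'b"
  where "scaleR_fun c f = (\<lambda>x. c *\<^sub>R f x)"

instance
  by standard (simp_all add: scaleR_fun_def fun_eq_iff scaleR_add_right scaleR_add_left)

end


section \<open>Smooth manifolds\<close>

fun C_k_on :: "nat \<Rightarrow> 'a::real_normed_vector set \<Rightarrow> ('a \<Rightarrow> 'b::real_normed_vector) \<Rightarrow> bool" where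
  "C_k_on 0 S f \<longleftrightarrow> continuous_on S f"
| "C_k_on (Suc k) S f \<longleftrightarrow>
     (\<forall>x\<in>S. f differentiable (at x)) \<and> (\<forall>v. C_k_on k S (\<lambda>x. frechet_derivative f (at x) v))"

text \<open>Only used for open \<open>S\<close> in finite-dimensional spaces.\<close>

definition smooth_on :: "'a::real_normed_vector set \<Rightarrow> ('a \<Rightarrow> 'b::real_normed_vector) \<Rightarrow> bool"
  where "smooth_on S f \<longleftrightarrow> (\<forall>k. C_k_on k S f)"

text \<open>
  A chart is a pair \<open>(U, \<kappa>)\<close> of an open set and a homeomorphism from it onto an open subset of
  \<open>real ^ 'm\<close>; the values of \<open>\<kappa>\<close> outside \<open>U\<close> are irrelevant. The underlying set of the manifold is
  the whole type \<open>'p\<close>, whose class provides a Hausdorff and second countable topology. An atlas need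
  not be maximal: the smooth functions and the tangent spaces defined from it depend only on the
  maximal atlas containing it.
\<close>

type_synonym ('p, 'm) atlas = "('p set \<times> ('p \<Rightarrow> real ^ 'm)) set"

definition smooth_manifold ::
    "('p::{t2_space, second_countable_topology}, 'm::finite) atlas \<Rightarrow> bool" where
  "smooth_manifold A \<longleftrightarrow>
     (\<Union>(U, \<kappa>)\<in>A. U) = UNIV \<and>
     (\<forall>(U, \<kappa>)\<in>A. open U \<and> open (\<kappa> ` U) \<and> homeomorphism U (\<kappa> ` U) \<kappa> (inv_into U \<kappa>)) \<and>
     (\<forall>(U, \<kappa>)\<in>A. \<forall>(V, \<mu>)\<in>A. smooth_on (\<kappa> ` (U \<inter> V)) (\<mu> \<circ> inv_into U \<kappa>))"

definition smooth_functions :: "('p, 'm::finite) atlas \<Rightarrow> ('p \<Rightarrow> real) set" where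
  "smooth_functions A = {f. \<forall>(U, \<kappa>)\<in>A. smooth_on (\<kappa> ` U) (f \<circ> inv_into U \<kappa>)}"

type_synonym 'p tvector = "('p \<Rightarrow> real) \<Rightarrow> real"
type_synonym 'p vfield = "'p \<Rightarrow> 'p tvector"

text \<open>
  The tangent vectors at \<open>p\<close> are the directional derivatives \<open>\<Sum>i. u\<^sub>i \<partial>\<^sub>i|\<^sub>p\<close> of the charts around \<open>p\<close>,
  acting on smooth functions on the manifold. They are set to zero on functions that are not smooth,
  so that two tangent vectors are equal as soon as they agree on all smooth functions.
\<close>

definition tangent_space :: "('p, 'm::finite) atlas \<Rightarrow> 'p \<Rightarrow> 'p tvector set" where
  "tangent_space A p = {v. \<exists>(U, \<kappa>)\<in>A. p \<in> U \<and> (\<exists>u. v =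
     (\<lambda>f. if f \<in> smooth_functions A
          then frechet_derivative (f \<circ> inv_into U \<kappa>) (at (\<kappa> p)) u else 0))}"

definition vector_fields :: "('p, 'm::finite) atlas \<Rightarrow> 'p vfield set" where
  "vector_fields A = {X. (\<forall>p. X p \<in> tangent_space A p) \<and>
     (\<forall>f\<in>smooth_functions A. (\<lambda>p. X p f) \<in> smooth_functions A)}"

definition app :: "'p vfield \<Rightarrow> ('p \<Rightarrow> real) \<Rightarrow> 'p \<Rightarrow> real"
  where "app X f = (\<lambda>p. X p f)"

definition fmult :: "('p \<Rightarrow> real) \<Rightarrow> 'p vfield \<Rightarrow> 'p vfield"  (infixr \<open>\<cdot>\<^sub>F\<close> 75)
  where "h \<cdot>\<^sub>F X = (\<lambda>p. h p *\<^sub>R X p)"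

definition bracket :: "'p vfield \<Rightarrow> 'p vfield \<Rightarrow> 'p vfield"
  where "bracket X Y = (\<lambda>p f. X p (app Y f) - Y p (app X f))"


section \<open>Tensor fields\<close>

definition linear_map_on :: "'a::real_vector set \<Rightarrow> ('a \<Rightarrow> 'b::real_vector) \<Rightarrow> bool" where
  "linear_map_on V L \<longleftrightarrow>
     (\<forall>u\<in>V. \<forall>v\<in>V. L (u + v) = L u + L v) \<and> (\<forall>c. \<forall>v\<in>V. L (c *\<^sub>R v) = c *\<^sub>R L v)"

text \<open>
  Tensor fields are families of (multi)linear maps on the tangent spaces; their values outside the
  tangent spaces are irrelevant.
\<close>

type_synonym 'p one_form = "'p \<Rightarrow> 'p tvector \<Rightarrow> real"
type_synonym 'p two_tensor = "'p \<Rightarrow> 'p tvector \<Rightarrow> 'p tvector \<Rightarrow> real"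
type_synonym 'p endo = "'p \<Rightarrow> 'p tvector \<Rightarrow> 'p tvector"

definition eval1 :: "'p one_form \<Rightarrow> 'p vfield \<Rightarrow> 'p \<Rightarrow> real"
  where "eval1 \<omega> X = (\<lambda>p. \<omega> p (X p))"

definition eval2 :: "'p two_tensor \<Rightarrow> 'p vfield \<Rightarrow> 'p vfield \<Rightarrow> 'p \<Rightarrow> real"
  where "eval2 t X Y = (\<lambda>p. t p (X p) (Y p))"

definition eval_endo :: "'p endo \<Rightarrow> 'p vfield \<Rightarrow> 'p vfield"
  where "eval_endo T X = (\<lambda>p. T p (X p))"

definition smooth_one_form :: "('p, 'm::finite) atlas \<Rightarrow> 'p one_form \<Rightarrow> bool" where
  "smooth_one_form A \<omega> \<longleftrightarrow> (\<forall>p. linear_map_on (tangent_space A p) (\<omega> p)) \<and>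
     (\<forall>X\<in>vector_fields A. eval1 \<omega> X \<in> smooth_functions A)"

definition smooth_endo :: "('p, 'm::finite) atlas \<Rightarrow> 'p endo \<Rightarrow> bool" where
  "smooth_endo A T \<longleftrightarrow>
     (\<forall>p. linear_map_on (tangent_space A p) (T p) \<and> T p ` tangent_space A p \<subseteq> tangent_space A p) \<and>
     (\<forall>X\<in>vector_fields A. eval_endo T X \<in> vector_fields A)"

definition riemannian_metric :: "('p, 'm::finite) atlas \<Rightarrow> 'p two_tensor \<Rightarrow> bool" where
  "riemannian_metric A g \<longleftrightarrow>
     (\<forall>p. \<forall>u\<in>tangent_space A p.
        linear_map_on (tangent_space A p) (g p u) \<and>
        (\<forall>v\<in>tangent_space A p. g p u v = g p v u) \<and>
        (u \<noteq> 0 \<longrightarrow> g p u u > 0)) \<and>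
     (\<forall>X\<in>vector_fields A. \<forall>Y\<in>vector_fields A. eval2 g X Y \<in> smooth_functions A)"

definition lie_derivative_2 :: "'p vfield \<Rightarrow> 'p two_tensor \<Rightarrow> 'p vfield \<Rightarrow> 'p vfield \<Rightarrow> 'p \<Rightarrow> real"
  where "lie_derivative_2 Z t X Y =
    app Z (eval2 t X Y) - eval2 t (bracket Z X) Y - eval2 t X (bracket Z Y)"


section \<open>Connections and differential operators\<close>

type_synonym 'p connection = "'p vfield \<Rightarrow> 'p vfield \<Rightarrow> 'p vfield"

definition affine_connection :: "('p, 'm::finite) atlas \<Rightarrow> 'p connection \<Rightarrow> bool" where
  "affine_connection A D \<longleftrightarrow>
     (\<forall>X\<in>vector_fields A. \<forall>Y\<in>vector_fields A. D X Y \<in> vector_fields A) \<and>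
     (\<forall>X\<in>vector_fields A. \<forall>Y\<in>vector_fields A. \<forall>Z\<in>vector_fields A.
        D (X + Y) Z = D X Z + D Y Z \<and> D X (Y + Z) = D X Y + D X Z) \<and>
     (\<forall>f\<in>smooth_functions A. \<forall>X\<in>vector_fields A. \<forall>Y\<in>vector_fields A.
        D (f \<cdot>\<^sub>F X) Y = f \<cdot>\<^sub>F D X Y \<and> D X (f \<cdot>\<^sub>F Y) = app X f \<cdot>\<^sub>F Y + f \<cdot>\<^sub>F D X Y)"

definition levi_civita :: "('p, 'm::finite) atlas \<Rightarrow> 'p two_tensor \<Rightarrow> 'p connection \<Rightarrow> bool" where
  "levi_civita A g D \<longleftrightarrow> affine_connection A D \<and>
     (\<forall>X\<in>vector_fields A. \<forall>Y\<in>vector_fields A. D X Y - D Y X = bracket X Y) \<and>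
     (\<forall>X\<in>vector_fields A. \<forall>Y\<in>vector_fields A. \<forall>Z\<in>vector_fields A.
        app X (eval2 g Y Z) = eval2 g (D X Y) Z + eval2 g Y (D X Z))"

definition cov_deriv_endo :: "'p connection \<Rightarrow> 'p endo \<Rightarrow> 'p vfield \<Rightarrow> 'p vfield \<Rightarrow> 'p vfield"
  where "cov_deriv_endo D T X Y = D X (eval_endo T Y) - eval_endo T (D X Y)"

definition hessian ::
    "'p connection \<Rightarrow> ('p \<Rightarrow> real) \<Rightarrow> 'p vfield \<Rightarrow> 'p vfield \<Rightarrow> 'p \<Rightarrow> real"
  where "hessian D f X Y = app X (app Y f) - app (D X Y) f"

definition gradient :: "('p, 'm::finite) atlas \<Rightarrow> 'p two_tensor \<Rightarrow> ('p \<Rightarrow> real) \<Rightarrow> 'p vfield" where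
  "gradient A g f = (\<lambda>p. THE v. v \<in> tangent_space A p \<and> (\<forall>w\<in>tangent_space A p. g p v w = w f))"

text \<open>The trace of an endomorphism of a finite-dimensional subspace \<open>V\<close>.\<close>

definition trace_on :: "'a::real_vector set \<Rightarrow> ('a \<Rightarrow> 'a) \<Rightarrow> real" where
  "trace_on V L =
     (let B = (SOME B. independent B \<and> span B = V) in \<Sum>b\<in>B. representation B (L b) b)"

text \<open>
  The divergence of \<open>X\<close> at \<open>p\<close> is the trace of \<open>v \<mapsto> \<nabla>\<^sub>v X\<close> on the tangent space at \<open>p\<close>, where
  \<open>\<nabla>\<^sub>v X\<close> is the value at \<open>p\<close> of \<open>\<nabla>\<^sub>V X\<close> for any smooth vector field \<open>V\<close> extending \<open>v\<close>.
\<close>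

definition cov_deriv_at ::
    "('p, 'm::finite) atlas \<Rightarrow> 'p connection \<Rightarrow> 'p vfield \<Rightarrow> 'p \<Rightarrow> 'p tvector \<Rightarrow> 'p tvector"
  where "cov_deriv_at A D X p v = D (SOME V. V \<in> vector_fields A \<and> V p = v) X p"

definition divergence :: "('p, 'm::finite) atlas \<Rightarrow> 'p connection \<Rightarrow> 'p vfield \<Rightarrow> 'p \<Rightarrow> real"
  where "divergence A D X = (\<lambda>p. trace_on (tangent_space A p) (cov_deriv_at A D X p))"

definition laplacian ::
    "('p, 'm::finite) atlas \<Rightarrow> 'p two_tensor \<Rightarrow> 'p connection \<Rightarrow> ('p \<Rightarrow> real) \<Rightarrow> 'p \<Rightarrow> real"
  where "laplacian A g D f = divergence A D (gradient A g f)"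


section \<open>Kenmotsu manifolds\<close>

definition almost_contact_metric ::
    "('p::{t2_space, second_countable_topology}, 'm::finite) atlas
      \<Rightarrow> 'p endo \<Rightarrow> 'p vfield \<Rightarrow> 'p one_form \<Rightarrow> 'p two_tensor \<Rightarrow> bool" where
  "almost_contact_metric A \<phi> \<xi> \<eta> g \<longleftrightarrow>
     smooth_manifold A \<and> odd CARD('m) \<and> CARD('m) \<ge> 3 \<and>
     riemannian_metric A g \<and> smooth_endo A \<phi> \<and> \<xi> \<in> vector_fields A \<and> smooth_one_form A \<eta> \<and>
     (\<forall>p. \<eta> p (\<xi> p) = 1) \<and>
     (\<forall>p. \<forall>u\<in>tangent_space A p.
        \<phi> p (\<phi> p u) = - u + \<eta> p u *\<^sub>R \<xi> p \<and>
        \<eta> p u = g p (\<xi> p) u \<and>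
        (\<forall>v\<in>tangent_space A p. g p (\<phi> p u) (\<phi> p v) = g p u v - \<eta> p u * \<eta> p v))"

text \<open>Here \<open>D\<close> is the Levi-Civita connection of \<open>g\<close>, which is unique on smooth vector fields.\<close>

definition kenmotsu ::
    "('p::{t2_space, second_countable_topology}, 'm::finite) atlas
      \<Rightarrow> 'p endo \<Rightarrow> 'p vfield \<Rightarrow> 'p one_form \<Rightarrow> 'p two_tensor \<Rightarrow> 'p connection \<Rightarrow> bool" where
  "kenmotsu A \<phi> \<xi> \<eta> g D \<longleftrightarrow>
     almost_contact_metric A \<phi> \<xi> \<eta> g \<and> levi_civita A g D \<and>
     (\<forall>X\<in>vector_fields A. \<forall>Y\<in>vector_fields A.
        cov_deriv_endo D \<phi> X Y =
          eval2 g (eval_endo \<phi> X) Y \<cdot>\<^sub>F \<xi> - eval1 \<eta> Y \<cdot>\<^sub>F eval_endo \<phi> X)"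

definition D_homothetic ::
    "real \<Rightarrow> 'p endo \<times> 'p vfield \<times> 'p one_form \<times> 'p two_tensor
      \<Rightarrow> 'p endo \<times> 'p vfield \<times> 'p one_form \<times> 'p two_tensor" where
  "D_homothetic a = (\<lambda>(\<phi>, \<xi>, \<eta>, g).
     (\<phi>, (1 / a) *\<^sub>R \<xi>, (\<lambda>p u. a * \<eta> p u),
      (\<lambda>p u v. a * g p u v + a * (a - 1) * (\<eta> p u * \<eta> p v))))"

end

theory Submission
  imports Defs
begin

text \<open>
  Everything follows from one formula for the Levi-Civita connection of the deformed metric,
  \<open>D'\<^sub>X Y = D\<^sub>X Y + (a - 1) / a h(X,Y) \<xi>\<close> with \<open>h = g - \<eta> \<otimes> \<eta>\<close>. The Kenmotsu identity gives
  \<open>D\<^sub>X \<xi> = X - \<eta>(X) \<xi>\<close> (\<open>connection_xi\<close>) and hence \<open>(D\<^sub>X \<eta>)(Y) = h(X,Y)\<close> (\<open>derivative_eta\<close>). With this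
  one sees that the right-hand side is torsion-free and compatible with the deformed metric
  (\<open>levi_civita_deformed\<close>), and it agrees with \<open>D'\<close> because a Levi-Civita connection is unique
  (\<open>levi_civita_unique\<close>).

  The formulas for \<open>\<phi>\<close>, \<open>\<xi>\<close>, the Lie derivative and the Hessian are then pointwise computations. The
  divergence does not change because the correction \<open>V \<mapsto> (a - 1) / a h(V,X) \<xi>\<close> is an endomorphism of
  rank one with trace \<open>(a - 1) / a h(\<xi>,X) = 0\<close> (\<open>divergence'_eq\<close>), and \<open>div \<xi>\<close> is the trace of the
  projection \<open>I - \<eta> \<otimes> \<xi>\<close>, the dimension minus one. The gradient is found by checking which vector
  represents the differential of \<open>f\<close> in the deformed metric (\<open>gradient'_eq\<close>), and its divergence is the
  Laplacian (\<open>laplacian'_eq\<close>).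

  Three facts about manifolds enter. Tangent spaces, defined as spaces of operators on global
  functions, have the dimension of the manifold (\<open>tangent_space_basis\<close>), and every tangent vector
  extends to a global vector field (\<open>extend_tangent_vector\<close>); both rest on smooth bump functions
  supported in a chart. The gradient of a smooth function is a smooth vector field
  (\<open>vector_fields_gradient\<close>), by Cramer's rule in a local frame.
\<close>

section \<open>Maps of class C^k on open sets\<close>

lemma C_k_on_cong:
  assumes "open S" "\<And>x. x \<in> S \<Longrightarrow> f x = g x" "C_k_on k S f"
  shows "C_k_on k S g"
  using assms(2,3)
proof (induction k arbitrary: f g)
  case 0
  then show ?case by (auto simp: cong: continuous_on_cong)
next
  case (Suc k)
  have D: "(g has_derivative frechet_derivative f (at x)) (at x)" if "x \<in> S" for x
    using that Suc.prems \<open>open S\<close> has_derivative_transform_within_open frechet_derivative_works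
    by (metis C_k_on.simps(2))
  then have "frechet_derivative g (at x) = frechet_derivative f (at x)" if "x \<in> S" for x
    using that frechet_derivative_at by metis
  then have "C_k_on k S (\<lambda>x. frechet_derivative g (at x) v)" for v
    using Suc.IH[of "\<lambda>x. frechet_derivative f (at x) v"] Suc.prems by auto
  then show ?case using D by (auto simp: differentiable_def)
qed

text \<open>
  The recursion for \<open>C_k_on\<close> refers to the operator \<open>frechet_derivative\<close>. On an open set it agrees
  with any derivative that has been computed by other means, so the closure properties below can be
  read off from the usual rules of differentiation.
\<close>

lemma C_k_on_SucI:
  assumes "open S" "\<And>x. x \<in> S \<Longrightarrow> (f has_derivative f' x) (at x)"
    and "\<And>v. C_k_on k S (\<lambda>x. f' x v)"
  shows "C_k_on (Suc k) S f"
proof -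
  have "f' x = frechet_derivative f (at x)" if "x \<in> S" for x
    using assms(2) that frechet_derivative_at by blast
  then have "C_k_on k S (\<lambda>x. frechet_derivative f (at x) v)" for v
    using C_k_on_cong[OF assms(1) _ assms(3)[of v]] by simp
  then show ?thesis using assms(2) by (auto simp: differentiable_def)
qed

lemma C_k_on_Suc_has_derivative:
  "C_k_on (Suc k) S f \<Longrightarrow> x \<in> S \<Longrightarrow> (f has_derivative frechet_derivative f (at x)) (at x)"
  by (simp add: frechet_derivative_works)

lemma C_k_on_Suc_derivative:
  "C_k_on (Suc k) S f \<Longrightarrow> C_k_on k S (\<lambda>x. frechet_derivative f (at x) v)"
  by simp

lemma C_k_on_lower: "C_k_on (Suc k) S f \<Longrightarrow> C_k_on k S f"
proof (induction k arbitrary: f)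
  case 0
  then show ?case
    by (auto intro!: continuous_at_imp_continuous_on differentiable_imp_continuous_within)
next
  case (Suc k)
  then show ?case by (metis C_k_on.simps(2))
qed

lemma C_k_on_local:
  assumes "\<And>x. x \<in> S \<Longrightarrow> \<exists>T. open T \<and> x \<in> T \<and> C_k_on k T f"
  shows "C_k_on k S f"
  using assms
proof (induction k arbitrary: f)
  case 0
  then show ?case
    by (fastforce intro!: continuous_at_imp_continuous_on simp: continuous_on_eq_continuous_at)
next
  case (Suc k)
  have "f differentiable (at x)" if "x \<in> S" for x using Suc.prems[OF that] by auto
  moreover have "C_k_on k S (\<lambda>x. frechet_derivative f (at x) v)" for v
    using Suc.prems by (intro Suc.IH) (metis C_k_on_Suc_derivative)
  ultimately show ?case by auto
qed

lemma C_k_on_subset: "C_k_on k S f \<Longrightarrow> T \<subseteq> S \<Longrightarrow> C_k_on k T f"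
  by (induction k arbitrary: f) (auto intro: continuous_on_subset)

lemma C_k_on_const: "C_k_on k S (\<lambda>x. c)"
  by (induction k arbitrary: c) (auto simp: frechet_derivative_const)

lemma C_k_on_bounded_linear:
  assumes "open S" "bounded_linear L" "C_k_on k S f"
  shows "C_k_on k S (\<lambda>x. L (f x))"
  using assms(3)
proof (induction k arbitrary: f)
  case 0
  then show ?case using assms(2) by (auto intro: bounded_linear.continuous_on)
next
  case (Suc k)
  show ?case
  proof (rule C_k_on_SucI[OF assms(1)])
    show "((\<lambda>x. L (f x)) has_derivative (\<lambda>v. L (frechet_derivative f (at x) v))) (at x)" if "x \<in> S" for x
      by (rule bounded_linear.has_derivative[OF assms(2) C_k_on_Suc_has_derivative[OF Suc.prems that]])
  qed (rule Suc.IH[OF C_k_on_Suc_derivative[OF Suc.prems]])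
qed

lemma C_k_on_add:
  assumes "open S" "C_k_on k S f" "C_k_on k S g"
  shows "C_k_on k S (\<lambda>x. f x + g x)"
  using assms(2,3)
proof (induction k arbitrary: f g)
  case 0
  then show ?case by (auto intro: continuous_intros)
next
  case (Suc k)
  show ?case
  proof (rule C_k_on_SucI[OF assms(1)])
    show "((\<lambda>x. f x + g x) has_derivative
        (\<lambda>v. frechet_derivative f (at x) v + frechet_derivative g (at x) v)) (at x)" if "x \<in> S" for x
      using that by (intro has_derivative_add Suc.prems[THEN C_k_on_Suc_has_derivative])
  qed (rule Suc.IH[OF Suc.prems[THEN C_k_on_Suc_derivative]])
qed

lemma C_k_on_sum:
  assumes "open S" "\<And>i. i \<in> I \<Longrightarrow> C_k_on k S (f i)"
  shows "C_k_on k S (\<lambda>x. \<Sum>i\<in>I. f i x)"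
  using assms(2) by (induction I rule: infinite_finite_induct)
    (auto intro!: C_k_on_const C_k_on_add assms(1))

text \<open>
  By the product rule the derivative is again a sum of two such products, in which one factor has lost
  one order of differentiability; the other factor is lowered to that order as well.
\<close>

lemma C_k_on_bounded_bilinear:
  assumes "open S" "bounded_bilinear B" "C_k_on k S f" "C_k_on k S g"
  shows "C_k_on k S (\<lambda>x. B (f x) (g x))"
  using assms(3,4)
proof (induction k arbitrary: f g)
  case 0
  then show ?case using assms(2) by (auto intro: bounded_bilinear.continuous_on)
next
  case (Suc k)
  note lower = Suc.prems[THEN C_k_on_lower] and D = Suc.prems[THEN C_k_on_Suc_derivative]
  have "C_k_on k S (\<lambda>x. B (f x) (frechet_derivative g (at x) v)
          + B (frechet_derivative f (at x) v) (g x))" for v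
    by (intro C_k_on_add assms(1) Suc.IH lower D)
  moreover have "((\<lambda>x. B (f x) (g x)) has_derivative (\<lambda>v. B (f x) (frechet_derivative g (at x) v)
          + B (frechet_derivative f (at x) v) (g x))) (at x)" if "x \<in> S" for x
    using that by (intro bounded_bilinear.FDERIV[OF assms(2)] Suc.prems[THEN C_k_on_Suc_has_derivative])
  ultimately show ?case by (rule C_k_on_SucI[OF assms(1), rotated])
qed

lemma C_k_on_inverse:
  fixes f :: "'a::real_normed_vector \<Rightarrow> real"
  assumes "open S" "C_k_on k S f" "\<And>x. x \<in> S \<Longrightarrow> f x \<noteq> 0"
  shows "C_k_on k S (\<lambda>x. inverse (f x))"
  using assms(2)
proof (induction k)
  case 0
  then show ?case using assms(3) by (auto intro: continuous_intros)
next
  case (Suc k)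
  have "C_k_on k S (\<lambda>x. inverse (f x) * frechet_derivative f (at x) v * inverse (f x))" for v
    using Suc.IH[OF C_k_on_lower[OF Suc.prems]] C_k_on_Suc_derivative[OF Suc.prems]
    by (intro C_k_on_bounded_bilinear[OF assms(1) bounded_bilinear_mult])
  then have "C_k_on k S (\<lambda>x. - (inverse (f x) * frechet_derivative f (at x) v * inverse (f x)))" for v
    by (rule C_k_on_bounded_linear[OF assms(1) bounded_linear_minus[OF bounded_linear_ident]])
  moreover have "((\<lambda>x. inverse (f x)) has_derivative
      (\<lambda>v. - (inverse (f x) * frechet_derivative f (at x) v * inverse (f x)))) (at x)" if "x \<in> S" for x
    using that by (intro Deriv.has_derivative_inverse assms(3) C_k_on_Suc_has_derivative[OF Suc.prems])
  ultimately show ?case by (rule C_k_on_SucI[OF assms(1), rotated])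
qed

text \<open>
  In the derivative \<open>Dg(f x)(Df(x) v)\<close> both the base point and the direction vary with \<open>x\<close>. Expanding
  the direction in the standard basis turns it into a sum of products of coordinates of \<open>Df(x) v\<close> with
  directional derivatives of \<open>g\<close> in fixed directions, composed with \<open>f\<close>; the induction hypothesis
  applies to the latter.
\<close>

lemma C_k_on_compose:
  fixes f :: "'a::real_normed_vector \<Rightarrow> 'b::euclidean_space"
  assumes "open S" "open T" "f ` S \<subseteq> T" "C_k_on k S f" "C_k_on k T g"
  shows "C_k_on k S (\<lambda>x. g (f x))"
  using assms(4,5)
proof (induction k arbitrary: g)
  case 0
  then show ?case using assms(3) by (auto intro: continuous_on_compose2)
next
  case (Suc k)
  let ?D = "\<lambda>x v. \<Sum>b\<in>Basis. (frechet_derivative f (at x) v \<bullet> b) *\<^sub>R frechet_derivative g (at (f x)) b"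
  have "((\<lambda>x. g (f x)) has_derivative ?D x) (at x)" if "x \<in> S" for x
  proof -
    have g: "(g has_derivative frechet_derivative g (at (f x))) (at (f x))"
      using C_k_on_Suc_has_derivative[OF Suc.prems(2)] assms(3) that by auto
    interpret g: bounded_linear "frechet_derivative g (at (f x))"
      using g by (rule has_derivative_bounded_linear)
    have "frechet_derivative g (at (f x)) w
        = (\<Sum>b\<in>Basis. (w \<bullet> b) *\<^sub>R frechet_derivative g (at (f x)) b)" for w
      by (subst euclidean_representation[of w, symmetric]) (simp only: g.sum g.scaleR)
    then have "(\<lambda>v. frechet_derivative g (at (f x)) (frechet_derivative f (at x) v)) = ?D x"
      by blast
    then show ?thesis
      using has_derivative_compose[OF C_k_on_Suc_has_derivative[OF Suc.prems(1) that] g] by metis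
  qed
  moreover have "C_k_on k S (\<lambda>x. ?D x v)" for v
    by (intro C_k_on_sum assms(1) C_k_on_bounded_bilinear[OF _ bounded_bilinear_scaleR]
        C_k_on_bounded_linear[OF _ bounded_linear_inner_left]
        C_k_on_Suc_derivative[OF Suc.prems(1)] Suc.IH C_k_on_lower[OF Suc.prems(1)]
        C_k_on_Suc_derivative[OF Suc.prems(2)])
  ultimately show ?case by (rule C_k_on_SucI[OF assms(1)])
qed

lemma C_k_on_id: "C_k_on k S (\<lambda>x. x)"
proof (cases k)
  case (Suc j)
  have "C_k_on (Suc j) UNIV (\<lambda>x::'a. x)"
    by (rule C_k_on_SucI[where f' = "\<lambda>x v. v"]) (auto intro: C_k_on_const)
  then show ?thesis using Suc C_k_on_subset by blast
qed auto

section \<open>Smooth maps and bump functions\<close>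

named_theorems smooth

lemma smooth_on_has_derivative:
  "smooth_on S f \<Longrightarrow> x \<in> S \<Longrightarrow> (f has_derivative frechet_derivative f (at x)) (at x)"
  unfolding smooth_on_def using C_k_on_Suc_has_derivative by blast

lemma smooth_on_derivative: "smooth_on S f \<Longrightarrow> smooth_on S (\<lambda>x. frechet_derivative f (at x) v)"
  unfolding smooth_on_def using C_k_on_Suc_derivative by blast

lemma smooth_on_cong: "smooth_on S f \<Longrightarrow> open S \<Longrightarrow> (\<And>x. x \<in> S \<Longrightarrow> f x = g x) \<Longrightarrow> smooth_on S g"
  unfolding smooth_on_def using C_k_on_cong by blast

lemma smooth_on_local:
  "(\<And>x. x \<in> S \<Longrightarrow> \<exists>T. open T \<and> x \<in> T \<and> smooth_on T f) \<Longrightarrow> smooth_on S f"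
  unfolding smooth_on_def by (meson C_k_on_local)

lemma smooth_on_subset: "smooth_on S f \<Longrightarrow> T \<subseteq> S \<Longrightarrow> smooth_on T f"
  unfolding smooth_on_def using C_k_on_subset by blast

lemma smooth_on_const [smooth]: "smooth_on S (\<lambda>x. c)"
  unfolding smooth_on_def using C_k_on_const by blast

lemma smooth_on_id [smooth]: "smooth_on S (\<lambda>x. x)"
  unfolding smooth_on_def using C_k_on_id by blast

lemma smooth_on_add [smooth]:
  "smooth_on S f \<Longrightarrow> smooth_on S g \<Longrightarrow> open S \<Longrightarrow> smooth_on S (\<lambda>x. f x + g x)"
  unfolding smooth_on_def using C_k_on_add by blast

lemma smooth_on_minus [smooth]: "smooth_on S f \<Longrightarrow> open S \<Longrightarrow> smooth_on S (\<lambda>x. - f x)"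
  unfolding smooth_on_def
  using C_k_on_bounded_linear[OF _ bounded_linear_minus[OF bounded_linear_ident]] by blast

lemma smooth_on_diff [smooth]:
  "smooth_on S f \<Longrightarrow> smooth_on S g \<Longrightarrow> open S \<Longrightarrow> smooth_on S (\<lambda>x. f x - g x)"
  using smooth_on_add[OF _ smooth_on_minus, of S f g] by simp

lemma smooth_on_inner [smooth]:
  fixes f g :: "'a::real_normed_vector \<Rightarrow> 'b::real_inner"
  shows "smooth_on S f \<Longrightarrow> smooth_on S g \<Longrightarrow> open S \<Longrightarrow> smooth_on S (\<lambda>x. f x \<bullet> g x)"
  unfolding smooth_on_def using C_k_on_bounded_bilinear[OF _ bounded_bilinear_inner] by blast

lemma smooth_on_mult [smooth]:
  fixes f g :: "'a::real_normed_vector \<Rightarrow> real"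
  shows "smooth_on S f \<Longrightarrow> smooth_on S g \<Longrightarrow> open S \<Longrightarrow> smooth_on S (\<lambda>x. f x * g x)"
  unfolding smooth_on_def using C_k_on_bounded_bilinear[OF _ bounded_bilinear_mult] by blast

lemma smooth_on_divide [smooth]:
  fixes f g :: "'a::real_normed_vector \<Rightarrow> real"
  assumes "smooth_on S f" "smooth_on S g" "open S" "\<And>x. x \<in> S \<Longrightarrow> g x \<noteq> 0"
  shows "smooth_on S (\<lambda>x. f x / g x)"
proof -
  have "smooth_on S (\<lambda>x. inverse (g x))"
    using assms(2-4) unfolding smooth_on_def by (metis C_k_on_inverse)
  then show ?thesis using smooth_on_mult assms by (simp add: divide_inverse)
qed

lemma smooth_on_compose:
  fixes f :: "'a::real_normed_vector \<Rightarrow> 'b::euclidean_space"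
  shows "smooth_on S f \<Longrightarrow> smooth_on T g \<Longrightarrow> f ` S \<subseteq> T \<Longrightarrow> open S \<Longrightarrow> open T
    \<Longrightarrow> smooth_on S (\<lambda>x. g (f x))"
  unfolding smooth_on_def using C_k_on_compose by blast

text \<open>
  The derivative of \<open>(1/t)^n exp (-1/t)\<close>, extended by zero, is a linear combination of functions of the same
  form. Treating all exponents \<open>n\<close> together makes the smoothness of these functions a plain induction
  on the order of differentiability.
\<close>

definition flat :: "nat \<Rightarrow> real \<Rightarrow> real"
  where "flat n t = (if t > 0 then (1 / t) ^ n * exp (- (1 / t)) else 0)"

lemma flat_tendsto_0: "(flat n \<longlongrightarrow> 0) (at 0)"
proof -
  have "((\<lambda>s::real. s ^ n * exp (- s)) \<longlongrightarrow> 0) at_top"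
    using tendsto_power_div_exp_0[of n] by (simp add: exp_minus divide_inverse)
  then have "((\<lambda>t::real. (inverse t) ^ n * exp (- inverse t)) \<longlongrightarrow> 0) (at_right 0)"
    by (rule filterlim_compose[OF _ filterlim_inverse_at_top_right])
  then have "(flat n \<longlongrightarrow> 0) (at_right 0)"
    by (rule Lim_transform_eventually)
      (auto simp: flat_def eventually_at_filter inverse_eq_divide)
  moreover have "(flat n \<longlongrightarrow> 0) (at_left 0)"
    by (rule tendsto_eventually) (auto simp: flat_def eventually_at_filter)
  ultimately show ?thesis by (simp add: filterlim_split_at)
qed

lemma has_real_derivative_flat:
  "(flat n has_real_derivative flat (n + 2) t - real n * flat (n + 1) t) (at t)"
proof -
  consider "t > 0" | "t < 0" | "t = 0" by linarith
  then show ?thesis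
  proof cases
    case 1
    have "((\<lambda>t. (1 / t) ^ n * exp (- (1 / t))) has_real_derivative
            flat (n + 2) t - real n * flat (n + 1) t) (at t)"
      using 1 by (auto intro!: derivative_eq_intros simp: flat_def)
        (cases n; simp add: field_simps power2_eq_square)
    then show ?thesis
      by (rule has_field_derivative_transform_within_open[where S = "{0<..}"])
        (use 1 in \<open>auto simp: flat_def\<close>)
  next
    case 2
    have "((\<lambda>t. 0) has_real_derivative flat (n + 2) t - real n * flat (n + 1) t) (at t)"
      using 2 by (simp add: flat_def)
    then show ?thesis
      by (rule has_field_derivative_transform_within_open[where S = "{..<0}"])
        (use 2 in \<open>auto simp: flat_def\<close>)
  next
    case 3
    \<comment> \<open>The difference quotient at the origin is itself a function of the family, with limit zero.\<close>
    have "(\<lambda>h. (flat n (0 + h) - flat n 0) / h) = flat (n + 1)"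
      by (simp add: flat_def fun_eq_iff)
    moreover have "flat (n + 2) 0 - real n * flat (n + 1) 0 = 0"
      by (simp add: flat_def)
    ultimately show ?thesis
      unfolding DERIV_def 3 by (metis flat_tendsto_0)
  qed
qed

lemma smooth_on_flat: "smooth_on UNIV (flat n)"
proof -
  have "C_k_on k UNIV (flat n)" for k
  proof (induction k arbitrary: n)
    case 0
    then show ?case
      using has_real_derivative_flat
      by (auto intro!: continuous_at_imp_continuous_on DERIV_isCont)
  next
    case (Suc k)
    have "C_k_on k UNIV (\<lambda>t. flat (n + 2) t * v + flat (n + 1) t * (- real n * v))" for v
      by (intro C_k_on_add C_k_on_bounded_linear[OF _ bounded_linear_mult_left] Suc open_UNIV)
    moreover have "(\<lambda>t. flat (n + 2) t * v + flat (n + 1) t * (- real n * v))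
        = (\<lambda>t. (flat (n + 2) t - real n * flat (n + 1) t) * v)" for v
      by (simp add: fun_eq_iff algebra_simps)
    ultimately show ?case
      by (intro C_k_on_SucI[where f' = "\<lambda>t v. (flat (n + 2) t - real n * flat (n + 1) t) * v"])
        (use has_real_derivative_flat in \<open>auto simp: has_field_derivative_def\<close>)
  qed
  then show ?thesis by (simp add: smooth_on_def)
qed

definition bump :: "'a::euclidean_space \<Rightarrow> real \<Rightarrow> 'a \<Rightarrow> real"
  where "bump c r x = flat 0 (r\<^sup>2 - (x - c) \<bullet> (x - c))"

lemma smooth_on_bump [smooth]: "open S \<Longrightarrow> smooth_on S (bump c r)"
  unfolding bump_def
  by (rule smooth_on_compose[OF _ smooth_on_flat]) (auto intro!: smooth)

lemma bump_pos:
  assumes "x \<in> ball c r"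
  shows "bump c r x > 0"
proof -
  have "(norm (x - c))\<^sup>2 < r\<^sup>2"
    using assms by (intro power_strict_mono) (auto simp: dist_norm norm_minus_commute)
  then show ?thesis by (simp add: bump_def flat_def power2_norm_eq_inner)
qed

lemma bump_eq_0: 
  assumes "r > 0" "x \<notin> cball c r"
  shows "bump c r x = 0"
proof -
  have "r < norm (x - c)" using assms by (simp add: dist_norm norm_minus_commute)
  then have "r\<^sup>2 \<le> (norm (x - c))\<^sup>2" using assms(1) by (intro power_mono) auto
  then show ?thesis by (simp add: bump_def flat_def power2_norm_eq_inner)
qed

section \<open>Smooth functions on a manifold\<close>

lemma sum_fun_apply: "(\<Sum>i\<in>I. F i) x = (\<Sum>i\<in>I. F i x)"
  by (induction I rule: infinite_finite_induct) auto

lemma scaleR_fun_apply [simp]: "(c *\<^sub>R f) x = c *\<^sub>R f x"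
  by (simp add: scaleR_fun_def)

lemma linear_map_on_sum:
  assumes "linear_map_on V L" "subspace V" "\<And>i. i \<in> I \<Longrightarrow> F i \<in> V"
  shows "L (\<Sum>i\<in>I. c i *\<^sub>R F i) = (\<Sum>i\<in>I. c i *\<^sub>R L (F i))"
proof -
  have L0: "L 0 = 0"
    using assms(1) subspace_0[OF assms(2)] unfolding linear_map_on_def by (metis scaleR_zero_left)
  show ?thesis
    using assms(3)
  proof (induction I rule: infinite_finite_induct)
    case (insert i I)
    have 1: "c i *\<^sub>R F i \<in> V" "F i \<in> V" "(\<Sum>i\<in>I. c i *\<^sub>R F i) \<in> V"
      using insert.prems by (auto intro!: subspace_sum subspace_scale assms(2))
    then have "L (c i *\<^sub>R F i + (\<Sum>i\<in>I. c i *\<^sub>R F i)) = c i *\<^sub>R L (F i) + L (\<Sum>i\<in>I. c i *\<^sub>R F i)"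
      using assms(1) unfolding linear_map_on_def by metis
    then show ?case using insert by simp
  qed (simp_all add: L0)
qed

locale manifold =
  fixes A :: "('p::{t2_space, second_countable_topology}, 'm::finite) atlas"
  assumes smooth_manifold: "smooth_manifold A"
begin

lemma chart_at: obtains U \<kappa> where "(U, \<kappa>) \<in> A" "p \<in> U"
proof -
  have "p \<in> (\<Union>(U, \<kappa>)\<in>A. U)"
    using smooth_manifold by (simp add: smooth_manifold_def)
  then show ?thesis using that by blast
qed

lemma
  assumes "(U, \<kappa>) \<in> A"
  shows chart_open: "open U" and chart_image_open: "open (\<kappa> ` U)"
    and chart_homeomorphism: "homeomorphism U (\<kappa> ` U) \<kappa> (inv_into U \<kappa>)"
  using assms smooth_manifold by (auto simp: smooth_manifold_def)

lemma chart_transition: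
  "(U, \<kappa>) \<in> A \<Longrightarrow> (V, \<mu>) \<in> A \<Longrightarrow> smooth_on (\<kappa> ` (U \<inter> V)) (\<mu> \<circ> inv_into U \<kappa>)"
  using smooth_manifold by (auto simp: smooth_manifold_def)

lemma chart_inverse [simp]: "(U, \<kappa>) \<in> A \<Longrightarrow> q \<in> U \<Longrightarrow> inv_into U \<kappa> (\<kappa> q) = q"
  using chart_homeomorphism homeomorphism_apply1 by metis

lemma open_chart_image:
  assumes "(U, \<kappa>) \<in> A" "open W" "W \<subseteq> U"
  shows "open (\<kappa> ` W)"
proof -
  have "\<kappa> ` W = \<kappa> ` U \<inter> inv_into U \<kappa> -` W"
    using assms by auto
  then show ?thesis
    using continuous_open_preimage[OF _ chart_image_open[OF assms(1)] assms(2)]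
      homeomorphism_cont2[OF chart_homeomorphism[OF assms(1)]] by metis
qed

lemma smooth_functionsD:
  "f \<in> smooth_functions A \<Longrightarrow> (U, \<kappa>) \<in> A \<Longrightarrow> W \<subseteq> U \<Longrightarrow> smooth_on (\<kappa> ` W) (f \<circ> inv_into U \<kappa>)"
  by (rule smooth_on_subset[of "\<kappa> ` U"]) (auto simp: smooth_functions_def)

text \<open>
  Since the transition maps are smooth, the smoothness of a function near a point can be tested in one
  chart around that point.
\<close>

lemma smooth_functionsI_local:
  assumes "\<And>p. \<exists>(U, \<kappa>)\<in>A. \<exists>W. open W \<and> p \<in> W \<and> W \<subseteq> U \<and> smooth_on (\<kappa> ` W) (f \<circ> inv_into U \<kappa>)"
  shows "f \<in> smooth_functions A"
  unfolding smooth_functions_def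
proof safe
  fix V \<mu> assume V: "(V, \<mu>) \<in> A"
  show "smooth_on (\<mu> ` V) (f \<circ> inv_into V \<mu>)"
  proof (rule smooth_on_local, safe)
    fix p assume p: "p \<in> V"
    obtain U \<kappa> W where U: "(U, \<kappa>) \<in> A" and W: "open W" "p \<in> W" "W \<subseteq> U"
      and f: "smooth_on (\<kappa> ` W) (f \<circ> inv_into U \<kappa>)"
      using assms[of p] by blast
    have open1: "open (\<mu> ` (V \<inter> W))"
      using open_chart_image[OF V] W chart_open[OF V] by blast
    have open2: "open (\<kappa> ` W)"
      using open_chart_image[OF U] W by blast
    have T: "smooth_on (\<mu> ` (V \<inter> W)) (\<kappa> \<circ> inv_into V \<mu>)"
      by (rule smooth_on_subset[OF chart_transition[OF V U]]) (use W in auto)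
    have "smooth_on (\<mu> ` (V \<inter> W)) (\<lambda>x. (f \<circ> inv_into U \<kappa>) ((\<kappa> \<circ> inv_into V \<mu>) x))"
      by (rule smooth_on_compose[OF T f _ open1 open2]) (use V in auto)
    then have "smooth_on (\<mu> ` (V \<inter> W)) (f \<circ> inv_into V \<mu>)"
      by (rule smooth_on_cong[OF _ open1]) (use V U W(3) in auto)
    then show "\<exists>T. open T \<and> \<mu> p \<in> T \<and> smooth_on T (f \<circ> inv_into V \<mu>)"
      using open1 p W(2) by blast
  qed
qed

text \<open>
  The form in which smoothness is used for objects given by Cramer's rule in a local frame: numerator
  and denominator are global smooth functions, and only the quotient has a local meaning.
\<close>

lemma smooth_functions_quotient_local:
  assumes "\<And>p. \<exists>W N d. open W \<and> p \<in> W \<and> N \<in> smooth_functions A \<and> d \<in> smooth_functions A \<and>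
    (\<forall>q\<in>W. d q \<noteq> 0 \<and> f q = N q / d q)"
  shows "f \<in> smooth_functions A"
proof (rule smooth_functionsI_local)
  fix p
  obtain W N d where W: "open W" "p \<in> W" and N: "N \<in> smooth_functions A"
    and d: "d \<in> smooth_functions A" and f: "\<And>q. q \<in> W \<Longrightarrow> d q \<noteq> 0 \<and> f q = N q / d q"
    using assms[of p] by blast
  obtain U \<kappa> where U: "(U, \<kappa>) \<in> A" "p \<in> U" by (rule chart_at)
  let ?W = "W \<inter> U"
  have opn: "open ?W" "open (\<kappa> ` ?W)"
    using open_chart_image[OF U(1)] W(1) chart_open[OF U(1)] by blast+
  have "smooth_on (\<kappa> ` ?W) (\<lambda>x. (N \<circ> inv_into U \<kappa>) x / (d \<circ> inv_into U \<kappa>) x)"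
    using opn f U(1) by (intro smooth smooth_functionsD N d) auto
  then have "smooth_on (\<kappa> ` ?W) (f \<circ> inv_into U \<kappa>)"
    by (rule smooth_on_cong[OF _ opn(2)]) (use f U(1) in auto)
  then show "\<exists>(U, \<kappa>)\<in>A. \<exists>W. open W \<and> p \<in> W \<and> W \<subseteq> U \<and> smooth_on (\<kappa> ` W) (f \<circ> inv_into U \<kappa>)"
    using U opn(1) W(2) by blast
qed

lemma smooth_functions_const: "(\<lambda>q. c) \<in> smooth_functions A"
  by (auto simp: smooth_functions_def comp_def intro: smooth)

lemma smooth_functions_add:
  "f \<in> smooth_functions A \<Longrightarrow> h \<in> smooth_functions A \<Longrightarrow> (\<lambda>q. f q + h q) \<in> smooth_functions A"
  by (fastforce simp: smooth_functions_def comp_def chart_image_open intro: smooth)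

lemma smooth_functions_diff:
  "f \<in> smooth_functions A \<Longrightarrow> h \<in> smooth_functions A \<Longrightarrow> (\<lambda>q. f q - h q) \<in> smooth_functions A"
  by (fastforce simp: smooth_functions_def comp_def chart_image_open intro: smooth)

lemma smooth_functions_mult:
  "f \<in> smooth_functions A \<Longrightarrow> h \<in> smooth_functions A \<Longrightarrow> (\<lambda>q. f q * h q) \<in> smooth_functions A"
  by (fastforce simp: smooth_functions_def comp_def chart_image_open intro: smooth)

lemma smooth_functions_sum:
  "(\<And>i. i \<in> I \<Longrightarrow> f i \<in> smooth_functions A) \<Longrightarrow> (\<lambda>q. \<Sum>i\<in>I. f i q) \<in> smooth_functions A"
  by (induction I rule: infinite_finite_induct)
    (auto intro: smooth_functions_const smooth_functions_add)

lemma smooth_functions_prod: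
  "(\<And>i. i \<in> I \<Longrightarrow> f i \<in> smooth_functions A) \<Longrightarrow> (\<lambda>q. \<Prod>i\<in>I. f i q) \<in> smooth_functions A"
  by (induction I rule: infinite_finite_induct)
    (auto intro: smooth_functions_const smooth_functions_mult)

lemma smooth_functions_det:
  fixes B :: "'p \<Rightarrow> real ^ 'n ^ 'n"
  assumes "\<And>i j. (\<lambda>q. B q $ i $ j) \<in> smooth_functions A"
  shows "(\<lambda>q. det (B q)) \<in> smooth_functions A"
  unfolding det_def
  by (intro smooth_functions_sum smooth_functions_mult smooth_functions_const
      smooth_functions_prod assms)

section \<open>Tangent vectors\<close>

definition coord_vector :: "'p set \<Rightarrow> ('p \<Rightarrow> real ^ 'm) \<Rightarrow> 'p \<Rightarrow> real ^ 'm \<Rightarrow> 'p tvector"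
  where "coord_vector U \<kappa> p u = (\<lambda>f. if f \<in> smooth_functions A
    then frechet_derivative (f \<circ> inv_into U \<kappa>) (at (\<kappa> p)) u else 0)"

lemma smooth_function_has_derivative:
  "f \<in> smooth_functions A \<Longrightarrow> (U, \<kappa>) \<in> A \<Longrightarrow> p \<in> U \<Longrightarrow>
    ((f \<circ> inv_into U \<kappa>) has_derivative (\<lambda>u. coord_vector U \<kappa> p u f)) (at (\<kappa> p))"
  using smooth_on_has_derivative[OF smooth_functionsD, of f U \<kappa> U "\<kappa> p"]
  by (simp add: coord_vector_def)

lemma coord_vector_eqI:
  assumes "f \<in> smooth_functions A" "((f \<circ> inv_into U \<kappa>) has_derivative f') (at (\<kappa> p))"
  shows "coord_vector U \<kappa> p u f = f' u"
  using frechet_derivative_at[OF assms(2)] assms(1) by (simp add: coord_vector_def)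

lemma linear_coord_vector:
  assumes "(U, \<kappa>) \<in> A" "p \<in> U"
  shows "linear (coord_vector U \<kappa> p)"
proof -
  have lin: "linear (\<lambda>u. coord_vector U \<kappa> p u f)" for f
  proof (cases "f \<in> smooth_functions A")
    case True
    then show ?thesis
      using smooth_function_has_derivative[OF _ assms] has_derivative_linear by blast
  next
    case False
    then show ?thesis by (simp add: coord_vector_def linear_zero)
  qed
  show ?thesis
    by (intro linearI ext) (simp_all add: linear_add[OF lin] linear_scale[OF lin])
qed

text \<open>
  By the chain rule, a change of charts transforms the coordinates of a tangent vector by the
  derivative of the transition map. Hence a single chart around \<open>p\<close> yields all tangent vectors at \<open>p\<close>.
\<close>

lemma coord_vector_transition:
  assumes "(U, \<kappa>) \<in> A" "(V, \<mu>) \<in> A" "p \<in> U" "p \<in> V"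
  shows "coord_vector V \<mu> p u
    = coord_vector U \<kappa> p (frechet_derivative (\<kappa> \<circ> inv_into V \<mu>) (at (\<mu> p)) u)"
proof
  fix f
  let ?T = "frechet_derivative (\<kappa> \<circ> inv_into V \<mu>) (at (\<mu> p))"
  show "coord_vector V \<mu> p u f = coord_vector U \<kappa> p (?T u) f"
  proof (cases "f \<in> smooth_functions A")
    case True
    have opn: "open (\<mu> ` (V \<inter> U))"
      by (intro open_chart_image[OF assms(2)] open_Int chart_open[OF assms(1)] chart_open[OF assms(2)]) auto
    have T: "((\<kappa> \<circ> inv_into V \<mu>) has_derivative ?T) (at (\<mu> p))"
      using smooth_on_has_derivative[OF chart_transition[OF assms(2,1)]] assms by blast
    have "((f \<circ> inv_into U \<kappa>) has_derivative (\<lambda>u. coord_vector U \<kappa> p u f))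
        (at ((\<kappa> \<circ> inv_into V \<mu>) (\<mu> p)))"
      using smooth_function_has_derivative[OF True assms(1,3)] assms by simp
    then have "((\<lambda>x. (f \<circ> inv_into U \<kappa>) ((\<kappa> \<circ> inv_into V \<mu>) x)) has_derivative
        (\<lambda>u. coord_vector U \<kappa> p (?T u) f)) (at (\<mu> p))"
      by (rule has_derivative_compose[OF T])
    then have "((f \<circ> inv_into V \<mu>) has_derivative (\<lambda>u. coord_vector U \<kappa> p (?T u) f)) (at (\<mu> p))"
      by (rule has_derivative_transform_within_open[OF _ opn]) (use assms in auto)
    then show ?thesis by (rule coord_vector_eqI[OF True])
  qed (simp add: coord_vector_def)
qed

lemma tangent_space_chart:
  assumes "(U, \<kappa>) \<in> A" "p \<in> U"
  shows "tangent_space A p = range (coord_vector U \<kappa> p)"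
proof -
  have T: "tangent_space A p
      = {v. \<exists>(V, \<mu>)\<in>A. p \<in> V \<and> (\<exists>u. v = coord_vector V \<mu> p u)}"
    unfolding tangent_space_def coord_vector_def ..
  show ?thesis
  proof safe
    fix v assume "v \<in> tangent_space A p"
    then obtain V \<mu> u where "(V, \<mu>) \<in> A" "p \<in> V" "v = coord_vector V \<mu> p u"
      unfolding T by blast
    then show "v \<in> range (coord_vector U \<kappa> p)"
      using coord_vector_transition assms by blast
  qed (use assms T in blast)
qed

lemma subspace_tangent_space: "subspace (tangent_space A p)"
proof -
  obtain U \<kappa> where "(U, \<kappa>) \<in> A" "p \<in> U" by (rule chart_at)
  then show ?thesis
    using tangent_space_chart linear_subspace_image[OF linear_coord_vector subspace_UNIV] by metis
qed

lemma tangent_vector_const: "v \<in> tangent_space A p \<Longrightarrow> v (\<lambda>q. c) = 0"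
proof -
  assume v: "v \<in> tangent_space A p"
  obtain U \<kappa> where U: "(U, \<kappa>) \<in> A" "p \<in> U" by (rule chart_at)
  obtain u where v: "v = coord_vector U \<kappa> p u"
    using v tangent_space_chart[OF U] by blast
  have "(((\<lambda>q. c) \<circ> inv_into U \<kappa>) has_derivative (\<lambda>u. 0)) (at (\<kappa> p))"
    by (simp add: comp_def)
  then show ?thesis
    unfolding v by (rule coord_vector_eqI[OF smooth_functions_const])
qed

lemma
  assumes "v \<in> tangent_space A p" "f \<in> smooth_functions A" "h \<in> smooth_functions A"
  shows tangent_vector_add: "v (\<lambda>q. f q + h q) = v f + v h"
    and tangent_vector_mult: "v (\<lambda>q. f q * h q) = f p * v h + h p * v f"
proof -
  obtain U \<kappa> where U: "(U, \<kappa>) \<in> A" "p \<in> U" by (rule chart_at)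
  obtain u where v: "v = coord_vector U \<kappa> p u"
    using assms(1) tangent_space_chart[OF U] by blast
  note D = smooth_function_has_derivative[OF assms(2) U] smooth_function_has_derivative[OF assms(3) U]
  have "(((\<lambda>q. f q + h q) \<circ> inv_into U \<kappa>) has_derivative
      (\<lambda>u. coord_vector U \<kappa> p u f + coord_vector U \<kappa> p u h)) (at (\<kappa> p))"
    using has_derivative_add[OF D] by (simp add: comp_def)
  then show "v (\<lambda>q. f q + h q) = v f + v h"
    unfolding v by (rule coord_vector_eqI[OF smooth_functions_add[OF assms(2,3)]])
  have "(((\<lambda>q. f q * h q) \<circ> inv_into U \<kappa>) has_derivative
      (\<lambda>u. f p * coord_vector U \<kappa> p u h + h p * coord_vector U \<kappa> p u f)) (at (\<kappa> p))"
    using has_derivative_mult[OF D] U by (simp add: comp_def mult.commute)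
  then show "v (\<lambda>q. f q * h q) = f p * v h + h p * v f"
    unfolding v by (rule coord_vector_eqI[OF smooth_functions_mult[OF assms(2,3)]])
qed

lemma tangent_vector_scale:
  "v \<in> tangent_space A p \<Longrightarrow> f \<in> smooth_functions A \<Longrightarrow> v (\<lambda>q. c * f q) = c * v f"
  by (simp add: tangent_vector_mult[OF _ smooth_functions_const] tangent_vector_const)

lemma vector_fields_tangent: "X \<in> vector_fields A \<Longrightarrow> X p \<in> tangent_space A p"
  by (simp add: vector_fields_def)

lemma vector_fields_smooth:
  "X \<in> vector_fields A \<Longrightarrow> f \<in> smooth_functions A \<Longrightarrow> (\<lambda>q. X q f) \<in> smooth_functions A"
  by (simp add: vector_fields_def)

lemma vector_fields_add: "X \<in> vector_fields A \<Longrightarrow> Y \<in> vector_fields A \<Longrightarrow> X + Y \<in> vector_fields A"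
  by (simp add: vector_fields_def smooth_functions_add subspace_add[OF subspace_tangent_space])

lemma vector_fields_fmult:
  "h \<in> smooth_functions A \<Longrightarrow> X \<in> vector_fields A \<Longrightarrow> h \<cdot>\<^sub>F X \<in> vector_fields A"
  by (simp add: vector_fields_def fmult_def smooth_functions_mult
      subspace_scale[OF subspace_tangent_space])

lemma vector_fields_scaleR: "X \<in> vector_fields A \<Longrightarrow> c *\<^sub>R X \<in> vector_fields A"
  using vector_fields_fmult[OF smooth_functions_const, of X c]
  by (simp add: fmult_def scaleR_fun_def)

lemma vector_fields_diff: "X \<in> vector_fields A \<Longrightarrow> Y \<in> vector_fields A \<Longrightarrow> X - Y \<in> vector_fields A"
  using vector_fields_add[OF _ vector_fields_scaleR, of X Y "-1"] by simp

lemma vector_fields_0: "0 \<in> vector_fields A"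
  by (simp add: vector_fields_def smooth_functions_const subspace_0[OF subspace_tangent_space])

lemma vector_fields_sum:
  "(\<And>i. i \<in> I \<Longrightarrow> X i \<in> vector_fields A) \<Longrightarrow> (\<Sum>i\<in>I. X i) \<in> vector_fields A"
  by (induction I rule: infinite_finite_induct) (auto intro: vector_fields_0 vector_fields_add)

section \<open>Extension of local objects and local frames\<close>

text \<open>
  A function \<open>h\<close> of the coordinates, multiplied by a bump function and extended by zero to the whole
  manifold. The global functions and vector fields with prescribed local behaviour below are of this form.
\<close>

definition cutoff :: "'p set \<Rightarrow> ('p \<Rightarrow> real ^ 'm) \<Rightarrow> real ^ 'm \<Rightarrow> real \<Rightarrow> (real ^ 'm \<Rightarrow> real) \<Rightarrow> 'p \<Rightarrow> real"
  where "cutoff U \<kappa> c r h = (\<lambda>q. if q \<in> U then bump c r (\<kappa> q) * h (\<kappa> q) else 0)"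

text \<open>
  Inside the chart the function is a product of smooth functions. The preimage \<open>K\<close> of the closed ball
  is compact, hence closed in a Hausdorff space, so every point outside the chart has the neighbourhood
  \<open>- K\<close>, on which the function vanishes.
\<close>

lemma smooth_functions_cutoff:
  assumes U: "(U, \<kappa>) \<in> A" and r: "r > 0" and ball: "cball c r \<subseteq> \<kappa> ` U"
    and h: "smooth_on (\<kappa> ` U) h"
  shows "cutoff U \<kappa> c r h \<in> smooth_functions A"
proof (rule smooth_functionsI_local)
  fix p
  let ?f = "cutoff U \<kappa> c r h"
  show "\<exists>(V, \<mu>)\<in>A. \<exists>W. open W \<and> p \<in> W \<and> W \<subseteq> V \<and> smooth_on (\<mu> ` W) (?f \<circ> inv_into V \<mu>)"
  proof (cases "p \<in> U")
    case True
    have "smooth_on (\<kappa> ` U) (\<lambda>x. bump c r x * h x)"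
      by (intro smooth h chart_image_open[OF U])
    then have "smooth_on (\<kappa> ` U) (?f \<circ> inv_into U \<kappa>)"
      by (rule smooth_on_cong[OF _ chart_image_open[OF U]]) (use U in \<open>auto simp: cutoff_def\<close>)
    then show ?thesis using U True chart_open[OF U] by blast
  next
    case False
    define K where "K = inv_into U \<kappa> ` cball c r"
    have "compact K"
      unfolding K_def
      by (rule compact_continuous_image[OF continuous_on_subset[OF
          homeomorphism_cont2[OF chart_homeomorphism[OF U]] ball]]) simp
    then have "closed K" by (rule compact_imp_closed)
    have f0: "?f q = 0" if "q \<notin> K" for q
    proof (cases "q \<in> U")
      case True
      then have "\<kappa> q \<notin> cball c r" using that U chart_inverse unfolding K_def by (metis imageI)
      then show ?thesis by (simp add: cutoff_def bump_eq_0[OF r])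
    qed (simp add: cutoff_def)
    have "K \<subseteq> U" using ball U unfolding K_def by (auto simp: inv_into_into)
    obtain V \<mu> where V: "(V, \<mu>) \<in> A" "p \<in> V" by (rule chart_at)
    let ?W = "V - K"
    have "open ?W" "p \<in> ?W" using \<open>closed K\<close> chart_open[OF V(1)] \<open>K \<subseteq> U\<close> False V(2) by auto
    moreover have "smooth_on (\<mu> ` ?W) (?f \<circ> inv_into V \<mu>)"
      by (rule smooth_on_cong[OF smooth_on_const[of _ 0] open_chart_image[OF V(1) \<open>open ?W\<close>]])
        (use V f0 in auto)
    ultimately show ?thesis using V(1) by blast
  qed
qed

lemma cutoff_has_derivative:
  assumes "(U, \<kappa>) \<in> A" "q \<in> U" "h (\<kappa> q) = 0" "(h has_derivative h') (at (\<kappa> q))"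
  shows "((cutoff U \<kappa> c r h \<circ> inv_into U \<kappa>) has_derivative (\<lambda>u. bump c r (\<kappa> q) * h' u)) (at (\<kappa> q))"
proof -
  have "(bump c r has_derivative frechet_derivative (bump c r) (at (\<kappa> q))) (at (\<kappa> q))"
    by (rule smooth_on_has_derivative[OF smooth_on_bump[OF open_UNIV] UNIV_I])
  from has_derivative_mult[OF this assms(4)]
  have "((\<lambda>x. bump c r x * h x) has_derivative (\<lambda>u. bump c r (\<kappa> q) * h' u)) (at (\<kappa> q))"
    by (simp add: assms(3))
  then show ?thesis
    by (rule has_derivative_transform_within_open[OF _ chart_image_open[OF assms(1)]])
      (use assms in \<open>auto simp: cutoff_def\<close>)
qed

lemma cball_in_chart:
  assumes "(U, \<kappa>) \<in> A" "p \<in> U"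
  obtains r where "r > 0" "cball (\<kappa> p) r \<subseteq> \<kappa> ` U"
proof -
  have "\<kappa> p \<in> \<kappa> ` U" using assms(2) by (rule imageI)
  then show ?thesis
    using chart_image_open[OF assms(1)] that unfolding open_contains_cball by blast
qed

text \<open>
  The linear function \<open>x \<mapsto> (x - \<kappa> p) \<bullet> u\<close>, cut off around \<open>p\<close>, has a derivative along \<open>u\<close> which is a
  positive multiple of \<open>u \<bullet> u\<close>. So a tangent vector that vanishes on all global smooth functions has
  zero coordinates.
\<close>

lemma inj_coord_vector:
  assumes U: "(U, \<kappa>) \<in> A" "p \<in> U"
  shows "inj (coord_vector U \<kappa> p)"
proof (rule linear_injective_0[THEN iffD2, OF linear_coord_vector[OF U]], safe)
  fix u assume u: "coord_vector U \<kappa> p u = 0"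
  obtain r where r: "r > 0" "cball (\<kappa> p) r \<subseteq> \<kappa> ` U" by (rule cball_in_chart[OF U])
  define h where "h = (\<lambda>x. (x - \<kappa> p) \<bullet> u)"
  have F: "cutoff U \<kappa> (\<kappa> p) r h \<in> smooth_functions A"
    by (rule smooth_functions_cutoff[OF U(1) r]) (auto simp: h_def intro!: smooth chart_image_open U)
  have h: "h (\<kappa> p) = 0" "(h has_derivative (\<lambda>w. w \<bullet> u)) (at (\<kappa> p))"
    unfolding h_def by (auto intro!: derivative_eq_intros)
  have "coord_vector U \<kappa> p u (cutoff U \<kappa> (\<kappa> p) r h) = bump (\<kappa> p) r (\<kappa> p) * (u \<bullet> u)"
    by (rule coord_vector_eqI[OF F cutoff_has_derivative[OF U h]])
  then show "u = 0" using u bump_pos[of "\<kappa> p" "\<kappa> p" r] r(1) by simp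
qed

lemma tangent_space_basis:
  obtains B where "finite B" "independent B" "span B = tangent_space A p" "card B = CARD('m)"
proof -
  obtain U \<kappa> where U: "(U, \<kappa>) \<in> A" "p \<in> U" by (rule chart_at)
  let ?L = "coord_vector U \<kappa> p"
  have 1: "independent (?L ` Basis)"
    using inj_coord_vector[OF U] linear_coord_vector[OF U]
    by (simp add: linear_independent_injective_image independent_Basis)
  have 2: "span (?L ` Basis) = tangent_space A p"
    by (simp add: linear_span_image[OF linear_coord_vector[OF U]] tangent_space_chart[OF U])
  have "inj_on ?L Basis" using inj_coord_vector[OF U] by (rule inj_on_subset) simp
  then have 3: "card (?L ` Basis) = CARD('m)" by (simp add: card_image)
  show ?thesis by (rule that[OF _ 1 2 3]) simp
qed

text \<open>
  The values of \<open>E\<close> form a basis of the tangent space at every point of \<open>W\<close>; bijectivity of the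
  coordinate map expresses both independence and spanning.
\<close>

definition frame_on :: "'p set \<Rightarrow> ('m \<Rightarrow> 'p vfield) \<Rightarrow> bool"
  where "frame_on W E \<longleftrightarrow> (\<forall>i. E i \<in> vector_fields A) \<and>
    (\<forall>q\<in>W. bij_betw (\<lambda>u. \<Sum>i\<in>UNIV. u $ i *\<^sub>R E i q) UNIV (tangent_space A q))"

lemma frame_onD:
  assumes "frame_on W E"
  shows "E i \<in> vector_fields A"
    and "q \<in> W \<Longrightarrow> bij_betw (\<lambda>u. \<Sum>i\<in>UNIV. u $ i *\<^sub>R E i q) UNIV (tangent_space A q)"
  using assms by (auto simp: frame_on_def)

text \<open>
  The coordinate vector fields, multiplied by a bump function, are globally defined, and they still
  form a basis wherever the bump function is positive.
\<close>

lemma local_frame: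
  obtains W and E :: "'m \<Rightarrow> 'p vfield"
  where "open W" "p \<in> W" "frame_on W E"
proof -
  obtain U \<kappa> where U: "(U, \<kappa>) \<in> A" "p \<in> U" by (rule chart_at)
  obtain r where r: "r > 0" "cball (\<kappa> p) r \<subseteq> \<kappa> ` U" by (rule cball_in_chart[OF U])
  define E where "E = (\<lambda>(i::'m) q f. if f \<in> smooth_functions A then
    cutoff U \<kappa> (\<kappa> p) r (\<lambda>x. frechet_derivative (f \<circ> inv_into U \<kappa>) (at x) (axis i 1)) q else 0)"
  have E_in: "E i q = bump (\<kappa> p) r (\<kappa> q) *\<^sub>R coord_vector U \<kappa> q (axis i 1)" if "q \<in> U" for i q
    using that by (auto simp: E_def cutoff_def coord_vector_def fun_eq_iff)
  have E_out: "E i q = 0" if "q \<notin> U" for i q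
    using that by (auto simp: E_def cutoff_def fun_eq_iff)
  have "E i q \<in> tangent_space A q" for i q
  proof (cases "q \<in> U")
    case True
    then have "coord_vector U \<kappa> q (axis i 1) \<in> tangent_space A q"
      using tangent_space_chart[OF U(1)] by blast
    then show ?thesis by (simp add: E_in[OF True] subspace_scale[OF subspace_tangent_space])
  qed (simp add: E_out subspace_0[OF subspace_tangent_space])
  moreover have "(\<lambda>q. E i q f) \<in> smooth_functions A" if f: "f \<in> smooth_functions A" for i f
    using f smooth_functions_cutoff[OF U(1) r smooth_on_derivative[OF smooth_functionsD[OF f U(1) order_refl]]]
    by (simp add: E_def)
  ultimately have E: "E i \<in> vector_fields A" for i by (simp add: vector_fields_def)
  define W where "W = U \<inter> \<kappa> -` ball (\<kappa> p) r"
  have "open W"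
    unfolding W_def
    using homeomorphism_cont1[OF chart_homeomorphism[OF U(1)]] chart_open[OF U(1)]
    by (intro continuous_open_preimage) auto
  moreover have "p \<in> W" using U r by (simp add: W_def)
  moreover have "bij_betw (\<lambda>u. \<Sum>i\<in>UNIV. u $ i *\<^sub>R E i q) UNIV (tangent_space A q)" if q: "q \<in> W" for q
  proof -
    have qU: "q \<in> U" and pos: "bump (\<kappa> p) r (\<kappa> q) \<noteq> 0"
      using q bump_pos[of "\<kappa> q" "\<kappa> p" r] by (auto simp: W_def)
    let ?b = "bump (\<kappa> p) r (\<kappa> q)" and ?L = "coord_vector U \<kappa> q"
    note lin = linear_coord_vector[OF U(1) qU]
    have "(\<Sum>i\<in>UNIV. u $ i *\<^sub>R E i q) = ?L (?b *\<^sub>R u)" for u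
    proof -
      have "?L u = ?L (\<Sum>i\<in>UNIV. u $ i *\<^sub>R axis i 1)"
        using basis_expansion[of u] by (simp add: scalar_mult_eq_scaleR)
      also have "\<dots> = (\<Sum>i\<in>UNIV. u $ i *\<^sub>R ?L (axis i 1))"
        by (simp add: linear_sum[OF lin] linear_scale[OF lin])
      finally show ?thesis
        by (simp add: E_in[OF qU] linear_scale[OF lin] scaleR_sum_right mult.commute)
    qed
    moreover have "bij_betw (\<lambda>u. ?L (?b *\<^sub>R u)) UNIV (tangent_space A q)"
      unfolding bij_betw_def
    proof
      show "inj (\<lambda>u. ?L (?b *\<^sub>R u))"
        using pos by (auto intro!: injI dest: injD[OF inj_coord_vector[OF U(1) qU]])
      have "range (\<lambda>u. ?b *\<^sub>R u :: real ^ 'm) = UNIV"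
        using pos by (intro surjI[of _ "\<lambda>u. (1 / ?b) *\<^sub>R u"]) simp
      then show "range (\<lambda>u. ?L (?b *\<^sub>R u)) = tangent_space A q"
        unfolding tangent_space_chart[OF U(1) qU] by (metis image_image)
    qed
    ultimately show ?thesis by simp
  qed
  ultimately show ?thesis using E by (intro that[of W E]) (auto simp: frame_on_def)
qed

lemma extend_tangent_vector:
  assumes "v \<in> tangent_space A p"
  obtains V where "V \<in> vector_fields A" "V p = v"
proof -
  obtain W E where "open W" "p \<in> W" and fr: "frame_on W E"
    by (rule local_frame[of p])
  note E = frame_onD(1)[OF fr] and bij = frame_onD(2)[OF fr]
  obtain u where u: "v = (\<Sum>i\<in>UNIV. u $ i *\<^sub>R E i p)"
    using bij[OF \<open>p \<in> W\<close>] assms by (auto simp: bij_betw_def)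
  show ?thesis
  proof
    show "(\<Sum>i\<in>UNIV. u $ i *\<^sub>R E i) \<in> vector_fields A"
      by (intro vector_fields_sum vector_fields_scaleR E)
    show "(\<Sum>i\<in>UNIV. u $ i *\<^sub>R E i) p = v"
      by (simp add: u sum_fun_apply)
  qed
qed

section \<open>The gradient of a smooth function\<close>

lemma
  assumes "riemannian_metric A g" "u \<in> tangent_space A p"
  shows metric_linear: "linear_map_on (tangent_space A p) (g p u)"
    and metric_sym: "v \<in> tangent_space A p \<Longrightarrow> g p u v = g p v u"
    and metric_pos: "u \<noteq> 0 \<Longrightarrow> g p u u > 0"
  using assms unfolding riemannian_metric_def by blast+

lemma metric_smooth:
  "riemannian_metric A g \<Longrightarrow> X \<in> vector_fields A \<Longrightarrow> Y \<in> vector_fields A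
    \<Longrightarrow> (\<lambda>q. g q (X q) (Y q)) \<in> smooth_functions A"
  unfolding riemannian_metric_def eval2_def by blast

lemma gradient_eqI:
  assumes g: "riemannian_metric A g" and v: "v \<in> tangent_space A p"
    and rep: "\<And>w. w \<in> tangent_space A p \<Longrightarrow> g p v w = w f"
  shows "gradient A g f p = v"
  unfolding gradient_def
proof (rule the_equality)
  fix u assume u: "u \<in> tangent_space A p \<and> (\<forall>w\<in>tangent_space A p. g p u w = w f)"
  define w where "w = u + (- 1) *\<^sub>R v"
  have w: "w \<in> tangent_space A p" "(- 1) *\<^sub>R v \<in> tangent_space A p"
    unfolding w_def
    using u v subspace_add[OF subspace_tangent_space] subspace_scale[OF subspace_tangent_space] by metis+
  have "g p w w = g p w u + (- 1) *\<^sub>R g p w v"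
    using metric_linear[OF g w(1)] u v w(2) unfolding linear_map_on_def w_def by metis
  also have "\<dots> = 0"
    using metric_sym[OF g w(1)] u v w(1) rep by simp
  finally have "w = 0" using metric_pos[OF g w(1)] by force
  then show "u = v" by (simp add: w_def)
qed (use v rep in blast)

text \<open>
  In a basis \<open>E\<close> the coordinates \<open>u\<close> of the gradient solve \<open>G u = (E\<^sub>i f)\<^sub>i\<close> with the Gram matrix \<open>G\<close>.
  This matrix is nonsingular, since \<open>G u = 0\<close> gives \<open>g(x, x) = 0\<close> for \<open>x = \<Sum>\<^sub>j u\<^sub>j E\<^sub>j\<close>. Cramer's rule
  expresses the solution in a form that depends smoothly on the base point.
\<close>

lemma gradient_in_frame:
  fixes E :: "'m \<Rightarrow> 'p tvector" and f
  assumes g: "riemannian_metric A g"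
    and bij: "bij_betw (\<lambda>u. \<Sum>i\<in>UNIV. u $ i *\<^sub>R E i) UNIV (tangent_space A p)"
  defines "G \<equiv> \<chi> i j. g p (E i) (E j)"
  defines "v \<equiv> \<Sum>k\<in>UNIV. (det (\<chi> i j. if j = k then E i f else G $ i $ j) / det G) *\<^sub>R E k"
  shows "det G \<noteq> 0" "gradient A g f p = v" "gradient A g f p \<in> tangent_space A p"
    and "\<And>w. w \<in> tangent_space A p \<Longrightarrow> g p (gradient A g f p) w = w f"
proof -
  have T: "(\<Sum>i\<in>UNIV. u $ i *\<^sub>R E i) \<in> tangent_space A p" for u
    using bij by (auto simp: bij_betw_def)
  have E: "E i \<in> tangent_space A p" for i
  proof -
    have "(\<Sum>j\<in>UNIV. axis i 1 $ j *\<^sub>R E j) = (\<Sum>j\<in>UNIV. if j = i then E j else 0)"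
      by (rule sum.cong) (auto simp: axis_def)
    then show ?thesis using T[of "axis i 1"] by simp
  qed
  have rep: "g p (E i) (\<Sum>j\<in>UNIV. u $ j *\<^sub>R E j) = (G *v u) $ i" for u i
    using linear_map_on_sum[OF metric_linear[OF g E] subspace_tangent_space, where F = E] E
    by (simp add: G_def matrix_vector_mult_def mult.commute)
  have "u = 0" if u: "G *v u = 0" for u
  proof -
    let ?x = "\<Sum>j\<in>UNIV. u $ j *\<^sub>R E j"
    have "g p ?x (E i) = 0" for i
      using rep[of i u] u metric_sym[OF g T E] by simp
    then have "g p ?x ?x = 0"
      using linear_map_on_sum[OF metric_linear[OF g T] subspace_tangent_space, where F = E] E by simp
    then have "?x = 0" using metric_pos[OF g T] by force
    moreover have "(\<Sum>j\<in>UNIV. (0 :: real ^ 'm) $ j *\<^sub>R E j) = 0" by simp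
    ultimately show "u = 0" using injD[OF bij_betw_imp_inj_on[OF bij], of u 0] by simp
  qed
  then show det: "det G \<noteq> 0"
    unfolding invertible_det_nz[symmetric] invertible_left_inverse matrix_left_invertible_ker by blast
  define u :: "real ^ 'm"
    where "u = (\<chi> k. det (\<chi> i j. if j = k then (\<chi> i. E i f) $ i else G $ i $ j) / det G)"
  have v: "v = (\<Sum>k\<in>UNIV. u $ k *\<^sub>R E k)" by (simp add: v_def u_def cong: if_cong)
  then have vT: "v \<in> tangent_space A p" using T by simp
  have "G *v u = (\<chi> i. E i f)"
    using cramer[OF det] u_def by blast
  then have vE: "g p v (E i) = E i f" for i
    using rep[of i u] metric_sym[OF g T E] v by simp
  have rep_v: "g p v w = w f" if "w \<in> tangent_space A p" for w
  proof -
    obtain y where w: "w = (\<Sum>i\<in>UNIV. y $ i *\<^sub>R E i)"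
      using bij \<open>w \<in> tangent_space A p\<close> by (auto simp: bij_betw_def)
    show ?thesis
      using linear_map_on_sum[OF metric_linear[OF g vT] subspace_tangent_space, where F = E] E vE
      by (simp add: w sum_fun_apply)
  qed
  show grad: "gradient A g f p = v" by (rule gradient_eqI[OF g vT]) (erule rep_v)
  show "gradient A g f p \<in> tangent_space A p" by (simp only: grad vT)
  show "g p (gradient A g f p) w = w f" if "w \<in> tangent_space A p" for w
    unfolding grad using that by (rule rep_v)
qed

lemma
  assumes g: "riemannian_metric A g"
  shows gradient_tangent: "gradient A g f p \<in> tangent_space A p"
    and gradient_rep: "w \<in> tangent_space A p \<Longrightarrow> g p (gradient A g f p) w = w f"
proof -
  obtain W E where "open W" "p \<in> W" and fr: "frame_on W E"
    by (rule local_frame[of p])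
  note E = frame_onD(1)[OF fr] and bij = frame_onD(2)[OF fr]
  show "gradient A g f p \<in> tangent_space A p"
    "w \<in> tangent_space A p \<Longrightarrow> g p (gradient A g f p) w = w f"
    by (rule gradient_in_frame(3,4)[OF g bij[OF \<open>p \<in> W\<close>]])+
qed

text \<open>
  In a local frame of global fields, the entries of the Gram matrix and the derivatives \<open>E\<^sub>i f\<close> are
  global smooth functions, and so are the determinants of Cramer's rule.
\<close>

lemma vector_fields_gradient:
  assumes g: "riemannian_metric A g" and f: "f \<in> smooth_functions A"
  shows "gradient A g f \<in> vector_fields A"
proof -
  have "(\<lambda>q. gradient A g f q h) \<in> smooth_functions A" if h: "h \<in> smooth_functions A" for h
  proof (rule smooth_functions_quotient_local)
    fix p
    obtain W E where W: "open W" "p \<in> W" and fr: "frame_on W E"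
      by (rule local_frame[of p])
    note E = frame_onD(1)[OF fr] and bij = frame_onD(2)[OF fr]
    define G where "G = (\<lambda>q. \<chi> i j. g q (E i q) (E j q))"
    define C where "C = (\<lambda>k q. \<chi> i j. if j = k then E i q f else G q $ i $ j)"
    have G: "(\<lambda>q. G q $ i $ j) \<in> smooth_functions A" for i j
      using metric_smooth[OF g E E] by (simp add: G_def)
    then have dG: "(\<lambda>q. det (G q)) \<in> smooth_functions A" by (rule smooth_functions_det)
    have "(\<lambda>q. C k q $ i $ j) \<in> smooth_functions A" for k i j
      using G vector_fields_smooth[OF E f] by (cases "j = k") (simp_all add: C_def)
    then have "(\<lambda>q. \<Sum>k\<in>UNIV. det (C k q) * E k q h) \<in> smooth_functions A"
      by (intro smooth_functions_sum smooth_functions_mult smooth_functions_det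
          vector_fields_smooth[OF E h])
    moreover have "det (G q) \<noteq> 0 \<and>
        gradient A g f q h = (\<Sum>k\<in>UNIV. det (C k q) * E k q h) / det (G q)" if "q \<in> W" for q
    proof -
      have "det (G q) \<noteq> 0"
        unfolding G_def by (rule gradient_in_frame(1)[OF g bij[OF that]])
      moreover have "gradient A g f q = (\<Sum>k\<in>UNIV. (det (C k q) / det (G q)) *\<^sub>R E k q)"
        unfolding C_def G_def by (rule gradient_in_frame(2)[OF g bij[OF that]])
      ultimately show ?thesis by (simp add: sum_fun_apply sum_divide_distrib)
    qed
    ultimately show "\<exists>W N d. open W \<and> p \<in> W \<and> N \<in> smooth_functions A \<and> d \<in> smooth_functions A \<and>
        (\<forall>q\<in>W. d q \<noteq> 0 \<and> gradient A g f q h = N q / d q)"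
      using W dG by blast
  qed
  then show ?thesis using gradient_tangent[OF g] by (simp add: vector_fields_def)
qed

end

section \<open>Traces\<close>

lemma trace_on_basis:
  assumes C: "finite C" "independent C" "span C = V"
  obtains B where "finite B" "independent B" "span B = V" "card B = card C"
    "\<forall>L. trace_on V L = (\<Sum>b\<in>B. representation B (L b) b)"
proof -
  define B where "B = (SOME B. independent B \<and> span B = V)"
  have "independent B \<and> span B = V"
    unfolding B_def by (rule someI[of _ C]) (use C in simp)
  then have B: "independent B" "span B = V" by simp_all
  have "finite B"
    using independent_span_bound[OF C(1) B(1)] B(2) C(3) span_superset[of B] by simp
  moreover have "span V = V"
    using span_span[of B] B(2) by simp
  then have "card B = card C"
    using dim_eq_card[OF _ B(1), of V] dim_eq_card[OF _ C(2), of V] B(2) C(3) by metis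
  moreover have "\<forall>L. trace_on V L = (\<Sum>b\<in>B. representation B (L b) b)"
    unfolding trace_on_def B_def[symmetric] Let_def by simp
  ultimately show ?thesis using B by (intro that[of B])
qed

context
  fixes C V :: "'a::real_vector set"
  assumes C: "finite C" "independent C" "span C = V"
begin

lemma trace_on_add:
  assumes "\<And>v. v \<in> V \<Longrightarrow> K v \<in> V" "\<And>v. v \<in> V \<Longrightarrow> L v \<in> V"
  shows "trace_on V (\<lambda>v. K v + L v) = trace_on V K + trace_on V L"
proof -
  obtain B where B: "finite B" "independent B" "span B = V" "card B = card C"
    and tr: "\<forall>L. trace_on V L = (\<Sum>b\<in>B. representation B (L b) b)"
    using C by (rule trace_on_basis)
  have "b \<in> V" if "b \<in> B" for b using that B(3) span_base by blast
  then show ?thesis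
    using assms B(3) by (simp add: tr representation_add[OF B(2)] flip: sum.distrib)
qed

lemma trace_on_scale:
  assumes "\<And>v. v \<in> V \<Longrightarrow> L v \<in> V"
  shows "trace_on V (\<lambda>v. c *\<^sub>R L v) = c * trace_on V L"
proof -
  obtain B where B: "finite B" "independent B" "span B = V" "card B = card C"
    and tr: "\<forall>L. trace_on V L = (\<Sum>b\<in>B. representation B (L b) b)"
    using C by (rule trace_on_basis)
  have "b \<in> V" if "b \<in> B" for b using that B(3) span_base by blast
  then show ?thesis
    using assms B(3) by (simp add: tr representation_scale[OF B(2)] sum_distrib_left)
qed

text \<open>
  Both sides are equal to \<open>\<Sum>\<^sub>b w\<^sub>b h(b)\<close>, where the \<open>w\<^sub>b\<close> are the coordinates of \<open>w\<close> in the basis that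
  computes the trace.
\<close>

lemma trace_on_rank_one:
  assumes "linear_map_on V h" "w \<in> V"
  shows "trace_on V (\<lambda>v. h v *\<^sub>R w) = h w"
proof -
  obtain B where B: "finite B" "independent B" "span B = V" "card B = card C"
    and tr: "\<forall>L. trace_on V L = (\<Sum>b\<in>B. representation B (L b) b)"
    using C by (rule trace_on_basis)
  have BV: "b \<in> V" if "b \<in> B" for b using that B(3) span_base by blast
  have "h w = h (\<Sum>b\<in>B. representation B w b *\<^sub>R b)"
    using sum_representation_eq[OF B(2) _ B(1)] assms(2) B(3) by simp
  also have "\<dots> = (\<Sum>b\<in>B. representation B w b *\<^sub>R h b)"
    using BV B(3) by (intro linear_map_on_sum[OF assms(1)]) (auto simp: subspace_span)
  finally show ?thesis
    using assms(2) B(3) by (simp add: tr representation_scale[OF B(2)] mult.commute)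
qed

lemma trace_on_id: "trace_on V (\<lambda>v. v) = real (card C)"
proof -
  obtain B where B: "finite B" "independent B" "span B = V" "card B = card C"
    and tr: "\<forall>L. trace_on V L = (\<Sum>b\<in>B. representation B (L b) b)"
    using C by (rule trace_on_basis)
  then show ?thesis by (simp add: representation_basis)
qed

lemma trace_on_cong:
  assumes "\<And>v. v \<in> V \<Longrightarrow> K v = L v"
  shows "trace_on V K = trace_on V L"
proof -
  obtain B where B: "finite B" "independent B" "span B = V" "card B = card C"
    and tr: "\<forall>L. trace_on V L = (\<Sum>b\<in>B. representation B (L b) b)"
    using C by (rule trace_on_basis)
  have "b \<in> V" if "b \<in> B" for b using that B(3) span_base by blast
  then show ?thesis using assms by (simp add: tr)
qed

end

section \<open>Connections and divergence\<close>

lemma fmult_apply [simp]: "(h \<cdot>\<^sub>F X) p = h p *\<^sub>R X p"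
  by (simp add: fmult_def)

lemma scaleR_eq_fmult: "c *\<^sub>R X = (\<lambda>q. c) \<cdot>\<^sub>F X"
  by (simp add: fun_eq_iff)

context manifold begin

lemma tangent_space_closed [simp]:
  "u \<in> tangent_space A p \<Longrightarrow> v \<in> tangent_space A p \<Longrightarrow> u + v \<in> tangent_space A p"
  "u \<in> tangent_space A p \<Longrightarrow> v \<in> tangent_space A p \<Longrightarrow> u - v \<in> tangent_space A p"
  "u \<in> tangent_space A p \<Longrightarrow> - u \<in> tangent_space A p"
  "u \<in> tangent_space A p \<Longrightarrow> c *\<^sub>R u \<in> tangent_space A p"
  "X \<in> vector_fields A \<Longrightarrow> X p \<in> tangent_space A p"
  using subspace_tangent_space
  by (simp_all add: subspace_add subspace_diff subspace_neg subspace_scale vector_fields_tangent)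

lemma linear_map_on_simps:
  assumes L: "linear_map_on (tangent_space A p) L" and u: "u \<in> tangent_space A p"
  shows "v \<in> tangent_space A p \<Longrightarrow> L (u + v) = L u + L v"
    and "v \<in> tangent_space A p \<Longrightarrow> L (u - v) = L u - L v"
    and "L (- u) = - L u" "L (c *\<^sub>R u) = c *\<^sub>R L u"
proof -
  have add: "L (u + v) = L u + L v" if "v \<in> tangent_space A p" for v
    using L u that by (simp add: linear_map_on_def)
  have scale: "L (c *\<^sub>R v) = c *\<^sub>R L v" if "v \<in> tangent_space A p" for v c
    using L that by (simp add: linear_map_on_def)
  show "L (- u) = - L u" "L (c *\<^sub>R u) = c *\<^sub>R L u"
    using scale[OF u, of "- 1"] scale[OF u] by simp_all
  assume v: "v \<in> tangent_space A p"
  show "L (u + v) = L u + L v" by (rule add[OF v])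
  show "L (u - v) = L u - L v"
    using add[of "- v"] scale[OF v, of "- 1"] v by simp
qed

lemma metric_simps:
  assumes g: "riemannian_metric A g" and u: "u \<in> tangent_space A p" and v: "v \<in> tangent_space A p"
  shows "w \<in> tangent_space A p \<Longrightarrow> g p u (v + w) = g p u v + g p u w"
    and "w \<in> tangent_space A p \<Longrightarrow> g p u (v - w) = g p u v - g p u w"
    and "g p u (- v) = - g p u v" "g p u (c *\<^sub>R v) = c * g p u v"
    and "w \<in> tangent_space A p \<Longrightarrow> g p (v + w) u = g p v u + g p w u"
    and "w \<in> tangent_space A p \<Longrightarrow> g p (v - w) u = g p v u - g p w u"
    and "g p (- v) u = - g p v u" "g p (c *\<^sub>R v) u = c * g p v u"
  using u v by (simp_all add: metric_sym[OF g, of _ p u] linear_map_on_simps[OF metric_linear[OF g u] v])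

lemma
  assumes "affine_connection A D" "X \<in> vector_fields A" "Y \<in> vector_fields A"
  shows connection_closed: "D X Y \<in> vector_fields A"
    and connection_add_left: "Z \<in> vector_fields A \<Longrightarrow> D (X + Y) Z = D X Z + D Y Z"
    and connection_add_right: "Z \<in> vector_fields A \<Longrightarrow> D X (Y + Z) = D X Y + D X Z"
    and connection_fmult_left: "f \<in> smooth_functions A \<Longrightarrow> D (f \<cdot>\<^sub>F X) Y = f \<cdot>\<^sub>F D X Y"
    and connection_fmult_right:
      "f \<in> smooth_functions A \<Longrightarrow> D X (f \<cdot>\<^sub>F Y) = app X f \<cdot>\<^sub>F Y + f \<cdot>\<^sub>F D X Y"
  using assms unfolding affine_connection_def by blast+

lemma connection_scaleR_right:
  assumes "affine_connection A D" "X \<in> vector_fields A" "Y \<in> vector_fields A"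
  shows "D X (c *\<^sub>R Y) = c *\<^sub>R D X Y"
proof -
  have "D X (c *\<^sub>R Y) = app X (\<lambda>q. c) \<cdot>\<^sub>F Y + (\<lambda>q. c) \<cdot>\<^sub>F D X Y"
    unfolding scaleR_eq_fmult[of c Y] by (rule connection_fmult_right[OF assms smooth_functions_const])
  moreover have "app X (\<lambda>q. c) = (\<lambda>q. 0)"
    using assms(2) by (simp add: app_def tangent_vector_const[OF vector_fields_tangent])
  ultimately show ?thesis
    by (simp add: fun_eq_iff)
qed

lemma connection_zero_right:
  assumes "affine_connection A D" "X \<in> vector_fields A"
  shows "D X 0 = 0"
  using connection_scaleR_right[OF assms vector_fields_0, of 0] by simp

text \<open>
  The vector field \<open>V\<close> chosen to extend \<open>v\<close> is the same for all connections and all differentiated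
  fields. Identities for \<open>D V X p\<close> that hold for all vector fields \<open>V\<close> therefore pass to
  \<open>cov_deriv_at\<close>.
\<close>

lemma cov_deriv_at_extension:
  assumes "v \<in> tangent_space A p"
  shows "\<exists>V\<in>vector_fields A. V p = v \<and> (\<forall>D X. cov_deriv_at A D X p v = D V X p)"
proof -
  obtain W where "W \<in> vector_fields A" "W p = v" using extend_tangent_vector[OF assms] by blast
  then have "(SOME V. V \<in> vector_fields A \<and> V p = v) \<in> vector_fields A \<and>
      (SOME V. V \<in> vector_fields A \<and> V p = v) p = v"
    by (intro someI[of "\<lambda>V. V \<in> vector_fields A \<and> V p = v" W]) simp
  then show ?thesis unfolding cov_deriv_at_def by blast
qed

lemma cov_deriv_at_tangent:
  assumes "affine_connection A D" "X \<in> vector_fields A" "v \<in> tangent_space A p"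
  shows "cov_deriv_at A D X p v \<in> tangent_space A p"
  using cov_deriv_at_extension[OF assms(3)] connection_closed[OF assms(1) _ assms(2)] by fastforce

lemma divergence_rule:
  assumes "\<And>V. V \<in> vector_fields A \<Longrightarrow> D V X p = L (V p)"
  shows "divergence A D X p = trace_on (tangent_space A p) L"
proof -
  obtain C where C: "finite C" "independent C" "span C = tangent_space A p"
    by (rule tangent_space_basis)
  show ?thesis
    unfolding divergence_def
    using cov_deriv_at_extension assms by (intro trace_on_cong[OF C]) metis
qed

lemma divergence_add:
  assumes D: "affine_connection A D" and X: "X \<in> vector_fields A" and Y: "Y \<in> vector_fields A"
  shows "divergence A D (X + Y) p = divergence A D X p + divergence A D Y p"
proof -
  obtain C where C: "finite C" "independent C" "span C = tangent_space A p"
    by (rule tangent_space_basis)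
  have "cov_deriv_at A D (X + Y) p v = cov_deriv_at A D X p v + cov_deriv_at A D Y p v"
    if "v \<in> tangent_space A p" for v
    using cov_deriv_at_extension[OF that] connection_add_right[OF D _ X Y] by fastforce
  then have "divergence A D (X + Y) p
      = trace_on (tangent_space A p) (\<lambda>v. cov_deriv_at A D X p v + cov_deriv_at A D Y p v)"
    unfolding divergence_def by (rule trace_on_cong[OF C])
  then show ?thesis
    using cov_deriv_at_tangent[OF D] X Y by (simp add: trace_on_add[OF C] divergence_def)
qed

text \<open>
  By the Leibniz rule \<open>D\<^sub>V (h X) = V(h) X + h D\<^sub>V X\<close>. The first summand has rank one as a function of
  \<open>V\<close>, and its trace is \<open>X(h)\<close>.
\<close>

lemma divergence_fmult:
  assumes D: "affine_connection A D" and X: "X \<in> vector_fields A" and h: "h \<in> smooth_functions A"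
  shows "divergence A D (h \<cdot>\<^sub>F X) p = X p h + h p * divergence A D X p"
proof -
  obtain C where C: "finite C" "independent C" "span C = tangent_space A p"
    by (rule tangent_space_basis)
  have "cov_deriv_at A D (h \<cdot>\<^sub>F X) p v = v h *\<^sub>R X p + h p *\<^sub>R cov_deriv_at A D X p v"
    if "v \<in> tangent_space A p" for v
    using cov_deriv_at_extension[OF that] connection_fmult_right[OF D _ X h] by (fastforce simp: app_def)
  then have "divergence A D (h \<cdot>\<^sub>F X) p
      = trace_on (tangent_space A p) (\<lambda>v. v h *\<^sub>R X p + h p *\<^sub>R cov_deriv_at A D X p v)"
    unfolding divergence_def by (rule trace_on_cong[OF C])
  also have "\<dots> = X p h + h p * divergence A D X p"
    using cov_deriv_at_tangent[OF D X] X
    by (simp add: trace_on_add[OF C] trace_on_scale[OF C] trace_on_rank_one[OF C] linear_map_on_def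
        divergence_def)
  finally show ?thesis .
qed

lemma divergence_scaleR:
  assumes "affine_connection A D" "X \<in> vector_fields A"
  shows "divergence A D (c *\<^sub>R X) p = c * divergence A D X p"
proof -
  show ?thesis
    unfolding scaleR_eq_fmult[of c X] divergence_fmult[OF assms smooth_functions_const]
      tangent_vector_const[OF vector_fields_tangent[OF assms(2)]] by simp
qed

lemma
  assumes "levi_civita A g D" "X \<in> vector_fields A" "Y \<in> vector_fields A"
  shows levi_civita_torsion: "D X Y - D Y X = bracket X Y"
    and levi_civita_metric: "Z \<in> vector_fields A \<Longrightarrow>
      X p (\<lambda>q. g q (Y q) (Z q)) = g p (D X Y p) (Z p) + g p (Y p) (D X Z p)"
proof -
  show "D X Y - D Y X = bracket X Y"
    using assms unfolding levi_civita_def by blast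
  assume "Z \<in> vector_fields A"
  then have "app X (eval2 g Y Z) = eval2 g (D X Y) Z + eval2 g Y (D X Z)"
    using assms unfolding levi_civita_def by blast
  then show "X p (\<lambda>q. g q (Y q) (Z q)) = g p (D X Y p) (Z p) + g p (Y p) (D X Z p)"
    by (simp add: app_def eval2_def fun_eq_iff)
qed

lemma levi_civita_affine: "levi_civita A g D \<Longrightarrow> affine_connection A D"
  by (simp add: levi_civita_def)

text \<open>
  For the difference \<open>S\<close> of the two connections, \<open>g(S(X,Y), Z)\<close> is symmetric in \<open>X, Y\<close> because both
  are torsion-free and skew in \<open>Y, Z\<close> because both are metric, hence it vanishes. Taking \<open>Z = S(X,Y)\<close>
  reduces the claim to the positivity of \<open>g\<close> at each point.
\<close>

lemma levi_civita_unique: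
  assumes g: "riemannian_metric A g" and D: "levi_civita A g D" and D': "levi_civita A g D'"
    and X: "X \<in> vector_fields A" and Y: "Y \<in> vector_fields A"
  shows "D X Y = D' X Y"
proof
  fix p
  define S where "S X Y = D X Y - D' X Y" for X Y
  note closed = connection_closed[OF levi_civita_affine[OF D]]
    connection_closed[OF levi_civita_affine[OF D']]
  have S: "S X Y \<in> vector_fields A" if "X \<in> vector_fields A" "Y \<in> vector_fields A" for X Y
    using that closed by (simp add: S_def vector_fields_diff)
  have sym: "S X Y = S Y X" if "X \<in> vector_fields A" "Y \<in> vector_fields A" for X Y
  proof -
    have "D X Y - D Y X = D' X Y - D' Y X"
      by (simp only: levi_civita_torsion[OF D that] levi_civita_torsion[OF D' that])
    then show ?thesis by (simp add: S_def algebra_simps)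
  qed
  have skew: "g p (S X Y p) (Z p) = - g p (S X Z p) (Y p)"
    if "X \<in> vector_fields A" "Y \<in> vector_fields A" "Z \<in> vector_fields A" for X Y Z
    using levi_civita_metric[OF D that, of p] levi_civita_metric[OF D' that, of p] that
    by (simp add: S_def metric_simps[OF g] closed metric_sym[OF g, of "Y p"])
  have "g p (S X Y p) (Z p) = 0" if "Z \<in> vector_fields A" for Z
    using skew[OF X Y that] skew[OF that X Y] skew[OF Y that X]
    by (simp add: sym[OF X Y] sym[OF that X] sym[OF Y that])
  from this[OF S[OF X Y]] have "S X Y p = 0"
    using metric_pos[OF g, of "S X Y p" p] S[OF X Y] by force
  then show "D X Y p = D' X Y p" by (simp add: S_def)
qed

end

section \<open>Kenmotsu manifolds\<close>

locale kenmotsu_manifold = manifold A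
  for A :: "('p::{t2_space, second_countable_topology}, 'm::finite) atlas" +
  fixes \<phi> :: "'p endo" and \<xi> :: "'p vfield" and \<eta> :: "'p one_form"
    and g :: "'p two_tensor" and D :: "'p connection"
  assumes kenmotsu: "kenmotsu A \<phi> \<xi> \<eta> g D"
begin

lemma almost_contact_metric: "almost_contact_metric A \<phi> \<xi> \<eta> g"
  and levi_civita: "levi_civita A g D"
  using kenmotsu by (simp_all add: kenmotsu_def)

lemma metric: "riemannian_metric A g"
  and phi_smooth: "smooth_endo A \<phi>"
  and xi_vector_field [simp]: "\<xi> \<in> vector_fields A"
  and eta_smooth: "smooth_one_form A \<eta>"
  and eta_xi [simp]: "\<eta> p (\<xi> p) = 1"
  using almost_contact_metric by (simp_all add: almost_contact_metric_def)

lemma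
  assumes "u \<in> tangent_space A p"
  shows phi_phi: "\<phi> p (\<phi> p u) = - u + \<eta> p u *\<^sub>R \<xi> p"
    and eta_eq: "\<eta> p u = g p (\<xi> p) u"
    and metric_phi: "v \<in> tangent_space A p \<Longrightarrow>
      g p (\<phi> p u) (\<phi> p v) = g p u v - \<eta> p u * \<eta> p v"
  using almost_contact_metric assms by (simp_all add: almost_contact_metric_def)

lemma phi_tangent [simp]: "u \<in> tangent_space A p \<Longrightarrow> \<phi> p u \<in> tangent_space A p"
  and linear_phi: "linear_map_on (tangent_space A p) (\<phi> p)"
  and phi_vector_field: "X \<in> vector_fields A \<Longrightarrow> eval_endo \<phi> X \<in> vector_fields A"
  using phi_smooth unfolding smooth_endo_def by blast+

lemma linear_eta: "linear_map_on (tangent_space A p) (\<eta> p)"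
  and eta_smooth_function: "X \<in> vector_fields A \<Longrightarrow> (\<lambda>q. \<eta> q (X q)) \<in> smooth_functions A"
  using eta_smooth unfolding smooth_one_form_def eval1_def by blast+

lemmas phi_linear = linear_map_on_simps[OF linear_phi]
lemmas eta_linear = linear_map_on_simps[OF linear_eta]
lemmas g_linear = metric_simps[OF metric]

lemma metric_xi_left: "u \<in> tangent_space A p \<Longrightarrow> g p (\<xi> p) u = \<eta> p u"
  and metric_xi_right: "u \<in> tangent_space A p \<Longrightarrow> g p u (\<xi> p) = \<eta> p u"
  using eta_eq metric_sym[OF metric] by simp_all

text \<open>
  The vector \<open>\<phi> \<xi>\<close> has length zero: \<open>g(\<phi> \<xi>, \<phi> \<xi>) = g(\<xi>, \<xi>) - \<eta>(\<xi>)\<^sup>2 = 1 - 1\<close>.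
\<close>

lemma phi_xi [simp]: "\<phi> p (\<xi> p) = 0"
proof -
  have "g p (\<phi> p (\<xi> p)) (\<phi> p (\<xi> p)) = 0"
    by (simp add: metric_phi metric_xi_left)
  then show ?thesis using metric_pos[OF metric, of "\<phi> p (\<xi> p)" p] by force
qed

text \<open>
  Computing \<open>\<phi>\<^sup>3 u\<close> as \<open>\<phi>(\<phi>\<^sup>2 u)\<close> gives \<open>- \<phi> u\<close>, because \<open>\<phi> \<xi> = 0\<close>; computing it as \<open>\<phi>\<^sup>2(\<phi> u)\<close> gives
  \<open>- \<phi> u + \<eta>(\<phi> u) \<xi>\<close>.
\<close>

lemma eta_phi: "u \<in> tangent_space A p \<Longrightarrow> \<eta> p (\<phi> p u) = 0"
proof -
  assume u: "u \<in> tangent_space A p"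
  have "\<phi> p (\<phi> p (\<phi> p u)) = - \<phi> p u"
    using u by (simp add: phi_phi phi_linear)
  then have "\<eta> p (\<phi> p u) *\<^sub>R \<xi> p = 0"
    using phi_phi[of "\<phi> p u" p] u by simp
  then have "\<eta> p (\<eta> p (\<phi> p u) *\<^sub>R \<xi> p) = \<eta> p (0 *\<^sub>R \<xi> p)" by (simp only: scaleR_zero_left)
  then show ?thesis by (simp add: eta_linear del: scaleR_zero_left)
qed

lemma metric_phi_skew:
  assumes "u \<in> tangent_space A p" "v \<in> tangent_space A p"
  shows "g p u (\<phi> p v) = - g p (\<phi> p u) v"
  using metric_phi[of u p "\<phi> p v"] assms
  by (simp add: phi_phi eta_phi g_linear metric_xi_right)

lemma connection_phi:
  assumes X: "X \<in> vector_fields A" and Y: "Y \<in> vector_fields A"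
  shows "D X (\<lambda>q. \<phi> q (Y q)) p =
    \<phi> p (D X Y p) + g p (\<phi> p (X p)) (Y p) *\<^sub>R \<xi> p - \<eta> p (Y p) *\<^sub>R \<phi> p (X p)"
proof -
  have "cov_deriv_endo D \<phi> X Y = eval2 g (eval_endo \<phi> X) Y \<cdot>\<^sub>F \<xi> - eval1 \<eta> Y \<cdot>\<^sub>F eval_endo \<phi> X"
    using kenmotsu X Y unfolding kenmotsu_def by blast
  from fun_cong[OF this, of p] show ?thesis
    by (simp add: cov_deriv_endo_def eval_endo_def eval1_def eval2_def algebra_simps)
qed

text \<open>
  The Kenmotsu identity for \<open>Y = \<xi>\<close> reads \<open>\<phi>(D\<^sub>X \<xi>) = \<phi> X\<close>, because \<open>\<phi> \<xi> = 0\<close> and \<open>\<eta> \<circ> \<phi> = 0\<close>. Applying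
  \<open>\<phi>\<close> once more determines \<open>D\<^sub>X \<xi>\<close> up to a multiple of \<open>\<xi>\<close>, and its component along \<open>\<xi>\<close> vanishes because
  \<open>\<xi>\<close> has constant length.
\<close>

lemma connection_xi:
  assumes X: "X \<in> vector_fields A"
  shows "D X \<xi> p = X p - \<eta> p (X p) *\<^sub>R \<xi> p"
proof -
  note affine = levi_civita_affine[OF levi_civita]
  have DX: "D X \<xi> \<in> vector_fields A" by (rule connection_closed[OF affine X]) simp
  have "X p (\<lambda>q. g q (\<xi> q) (\<xi> q)) = 2 * \<eta> p (D X \<xi> p)"
    using levi_civita_metric[OF levi_civita X, of \<xi> \<xi> p] DX
    by (simp add: metric_xi_left metric_xi_right)
  then have eta: "\<eta> p (D X \<xi> p) = 0"
    using X by (simp add: metric_xi_left tangent_vector_const[OF vector_fields_tangent])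
  have "(\<lambda>q. \<phi> q (\<xi> q)) = 0" by (simp add: fun_eq_iff)
  then have "\<phi> p (D X \<xi> p) + g p (\<phi> p (X p)) (\<xi> p) *\<^sub>R \<xi> p - \<eta> p (\<xi> p) *\<^sub>R \<phi> p (X p) = 0"
    using connection_phi[OF X xi_vector_field, of p] connection_zero_right[OF affine X] by simp
  then have "\<phi> p (D X \<xi> p) = \<phi> p (X p)"
    using X by (simp add: metric_xi_right eta_phi)
  then have "\<phi> p (\<phi> p (D X \<xi> p)) = \<phi> p (\<phi> p (X p))" by simp
  then show ?thesis using X DX eta by (simp add: phi_phi algebra_simps)
qed

text \<open>
  In terms of the covariant derivative of \<open>\<eta>\<close>: \<open>(D\<^sub>X \<eta>)(Y) = g(X,Y) - \<eta>(X) \<eta>(Y)\<close>. It follows from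
  \<open>\<eta>(Y) = g(\<xi>, Y)\<close> and the formula for \<open>D\<^sub>X \<xi>\<close>.
\<close>

lemma derivative_eta:
  assumes X: "X \<in> vector_fields A" and Y: "Y \<in> vector_fields A"
  shows "X p (\<lambda>q. \<eta> q (Y q)) = g p (X p) (Y p) - \<eta> p (X p) * \<eta> p (Y p) + \<eta> p (D X Y p)"
proof -
  have DY: "D X Y \<in> vector_fields A"
    by (rule connection_closed[OF levi_civita_affine[OF levi_civita] X Y])
  have "(\<lambda>q. \<eta> q (Y q)) = (\<lambda>q. g q (\<xi> q) (Y q))"
    using Y by (simp add: metric_xi_left)
  then show ?thesis
    using levi_civita_metric[OF levi_civita X _ Y, of \<xi> p] X Y DY
    by (simp add: connection_xi g_linear metric_xi_left)
qed

section \<open>The Levi-Civita connection of the deformed metric\<close>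

definition horizontal_metric :: "'p two_tensor"
  where "horizontal_metric p u v = g p u v - \<eta> p u * \<eta> p v"

definition deformed_metric :: "real \<Rightarrow> 'p two_tensor"
  where "deformed_metric a = (\<lambda>p u v. a * g p u v + a * (a - 1) * (\<eta> p u * \<eta> p v))"

text \<open>
  Differentiating the term \<open>a (a - 1) \<eta>(Y) \<eta>(Z)\<close> of the deformed metric along \<open>X\<close> produces the excess
  \<open>a (a - 1) (h(X,Y) \<eta>(Z) + h(X,Z) \<eta>(Y))\<close> with the horizontal metric \<open>h\<close>. A correction \<open>c h(X,Y) \<xi>\<close> of
  \<open>D\<^sub>X Y\<close> contributes \<open>c a\<^sup>2 (h(X,Y) \<eta>(Z) + h(X,Z) \<eta>(Y))\<close>, as \<open>\<xi>\<close> pairs with \<open>Z\<close> to \<open>a\<^sup>2 \<eta>(Z)\<close> in the deformed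
  metric. This forces \<open>c = (a - 1) / a\<close>.
\<close>

definition deformed_connection :: "real \<Rightarrow> 'p connection"
  where "deformed_connection a X Y =
    D X Y + (\<lambda>p. (a - 1) / a * horizontal_metric p (X p) (Y p)) \<cdot>\<^sub>F \<xi>"

lemma horizontal_metric_smooth:
  assumes "X \<in> vector_fields A" "Y \<in> vector_fields A"
  shows "(\<lambda>p. c * horizontal_metric p (X p) (Y p)) \<in> smooth_functions A"
  unfolding horizontal_metric_def
  by (intro smooth_functions_mult smooth_functions_diff smooth_functions_const
      metric_smooth[OF metric] eta_smooth_function assms)

text \<open>
  The deformed metric is \<open>a h + a\<^sup>2 \<eta> \<otimes> \<eta>\<close> with the horizontal metric \<open>h\<close>, and \<open>h(u,u) = g(\<phi> u, \<phi> u)\<close>. Both terms are nonnegative, and if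
  \<open>\<phi> u = 0\<close> then \<open>\<eta>(u)\<^sup>2 = g(u,u) > 0\<close> unless \<open>u = 0\<close>.
\<close>

lemma riemannian_deformed_metric:
  assumes a: "a > 0"
  shows "riemannian_metric A (deformed_metric a)"
  unfolding riemannian_metric_def
proof (intro allI conjI ballI impI)
  fix p u assume u: "u \<in> tangent_space A p"
  show "linear_map_on (tangent_space A p) (deformed_metric a p u)"
    unfolding linear_map_on_def
    using u by (simp add: deformed_metric_def g_linear eta_linear algebra_simps)
  show "deformed_metric a p u v = deformed_metric a p v u" if "v \<in> tangent_space A p" for v
    using metric_sym[OF metric u that] by (simp add: deformed_metric_def)
  assume "u \<noteq> 0"
  then have uu: "g p u u > 0" using metric_pos[OF metric u] by simp
  have split: "deformed_metric a p u u = a * g p (\<phi> p u) (\<phi> p u) + a\<^sup>2 * (\<eta> p u)\<^sup>2"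
    using u by (simp add: metric_phi deformed_metric_def algebra_simps power2_eq_square)
  show "deformed_metric a p u u > 0"
  proof (cases "\<phi> p u = 0")
    case True
    then have "g p u u = (\<eta> p u)\<^sup>2"
      using metric_phi[OF u u] g_linear(4)[of 0 p 0 0] subspace_0[OF subspace_tangent_space]
      by (simp add: power2_eq_square)
    then show ?thesis
      using uu a by (simp add: deformed_metric_def power2_eq_square algebra_simps)
  next
    case False
    then have "g p (\<phi> p u) (\<phi> p u) > 0" using metric_pos[OF metric] u by simp
    then show ?thesis unfolding split using a by (intro add_pos_nonneg) auto
  qed
next
  fix X Y assume "X \<in> vector_fields A" "Y \<in> vector_fields A"
  then show "eval2 (deformed_metric a) X Y \<in> smooth_functions A"
    unfolding eval2_def deformed_metric_def
    by (intro smooth_functions_add smooth_functions_mult smooth_functions_const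
        metric_smooth[OF metric] eta_smooth_function)
qed

lemma horizontal_metric_sym:
  "u \<in> tangent_space A p \<Longrightarrow> v \<in> tangent_space A p \<Longrightarrow>
    horizontal_metric p u v = horizontal_metric p v u"
  by (simp add: horizontal_metric_def metric_sym[OF metric])

lemma affine_deformed_connection: "affine_connection A (deformed_connection a)"
proof -
  note affine = levi_civita_affine[OF levi_civita]
  show ?thesis
    unfolding affine_connection_def
  proof (intro conjI ballI)
    fix X Y assume "X \<in> vector_fields A" "Y \<in> vector_fields A"
    then show "deformed_connection a X Y \<in> vector_fields A"
      unfolding deformed_connection_def
      by (intro vector_fields_add vector_fields_fmult horizontal_metric_smooth
          connection_closed[OF affine] xi_vector_field)
  next
    fix X Y Z assume X: "X \<in> vector_fields A" and Y: "Y \<in> vector_fields A" and Z: "Z \<in> vector_fields A"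
    show "deformed_connection a (X + Y) Z = deformed_connection a X Z + deformed_connection a Y Z"
      using X Y Z unfolding deformed_connection_def connection_add_left[OF affine X Y Z]
      by (intro ext[of "_ :: 'p vfield"])
        (simp add: horizontal_metric_def g_linear eta_linear algebra_simps flip: scaleR_add_left)
    show "deformed_connection a X (Y + Z) = deformed_connection a X Y + deformed_connection a X Z"
      using X Y Z unfolding deformed_connection_def connection_add_right[OF affine X Y Z]
      by (intro ext[of "_ :: 'p vfield"])
        (simp add: horizontal_metric_def g_linear eta_linear algebra_simps flip: scaleR_add_left)
  next
    fix f X Y assume f: "f \<in> smooth_functions A" and X: "X \<in> vector_fields A" and Y: "Y \<in> vector_fields A"
    show "deformed_connection a (f \<cdot>\<^sub>F X) Y = f \<cdot>\<^sub>F deformed_connection a X Y"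
      using X Y unfolding deformed_connection_def connection_fmult_left[OF affine X Y f]
      by (intro ext[of "_ :: 'p vfield"])
        (simp add: horizontal_metric_def g_linear eta_linear algebra_simps)
    show "deformed_connection a X (f \<cdot>\<^sub>F Y) = app X f \<cdot>\<^sub>F Y + f \<cdot>\<^sub>F deformed_connection a X Y"
      using X Y unfolding deformed_connection_def connection_fmult_right[OF affine X Y f]
      by (intro ext[of "_ :: 'p vfield"])
        (simp add: horizontal_metric_def g_linear eta_linear algebra_simps)
  qed
qed

text \<open>
  The correction term is symmetric in \<open>X, Y\<close>, so the torsion remains zero. Compatibility with the
  metric is the comparison of coefficients that determined the correction.
\<close>

lemma levi_civita_deformed:
  assumes a: "a > 0"
  shows "levi_civita A (deformed_metric a) (deformed_connection a)"
  unfolding levi_civita_def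
proof (intro conjI ballI affine_deformed_connection)
  fix X Y assume X: "X \<in> vector_fields A" and Y: "Y \<in> vector_fields A"
  have "deformed_connection a X Y - deformed_connection a Y X = D X Y - D Y X"
    using X Y by (intro ext[of "_ :: 'p vfield"])
      (simp add: deformed_connection_def horizontal_metric_sym)
  then show "deformed_connection a X Y - deformed_connection a Y X = bracket X Y"
    using levi_civita_torsion[OF levi_civita X Y] by simp
next
  fix X Y Z assume X: "X \<in> vector_fields A" and Y: "Y \<in> vector_fields A" and Z: "Z \<in> vector_fields A"
  note affine = levi_civita_affine[OF levi_civita]
  show "app X (eval2 (deformed_metric a) Y Z) =
    eval2 (deformed_metric a) (deformed_connection a X Y) Z +
    eval2 (deformed_metric a) Y (deformed_connection a X Z)"
  proof
    fix p
    note closed = connection_closed[OF affine X Y] connection_closed[OF affine X Z]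
    note T = vector_fields_tangent[OF X, of p]
    note sm = metric_smooth[OF metric Y Z] eta_smooth_function[OF Y] eta_smooth_function[OF Z]
    have "X p (\<lambda>q. deformed_metric a q (Y q) (Z q)) =
      a * (g p (D X Y p) (Z p) + g p (Y p) (D X Z p)) + a * (a - 1) *
      (\<eta> p (Y p) * (horizontal_metric p (X p) (Z p) + \<eta> p (D X Z p)) +
       \<eta> p (Z p) * (horizontal_metric p (X p) (Y p) + \<eta> p (D X Y p)))"
      unfolding deformed_metric_def
      using X Y Z sm by (simp add: tangent_vector_add[OF T] tangent_vector_scale[OF T] tangent_vector_mult[OF T]
          smooth_functions_mult smooth_functions_const derivative_eta
          levi_civita_metric[OF levi_civita] horizontal_metric_def)
    also have "\<dots> = deformed_metric a p (deformed_connection a X Y p) (Z p) +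
      deformed_metric a p (Y p) (deformed_connection a X Z p)"
      using X Y Z closed a
      by (simp add: deformed_metric_def deformed_connection_def g_linear eta_linear
          metric_xi_left metric_xi_right)
        (simp add: field_simps)
    finally show "app X (eval2 (deformed_metric a) Y Z) p =
      (eval2 (deformed_metric a) (deformed_connection a X Y) Z +
      eval2 (deformed_metric a) Y (deformed_connection a X Z)) p"
      by (simp add: app_def eval2_def)
  qed
qed

end

section \<open>Differential operators of the deformed structure\<close>

locale deformed_kenmotsu_manifold = kenmotsu_manifold A \<phi> \<xi> \<eta> g D
  for A :: "('p::{t2_space, second_countable_topology}, 'm::finite) atlas" and \<phi> \<xi> \<eta> g D +
  fixes a :: real and D' :: "'p connection"
  assumes a_pos: "a > 0" and levi_civita': "levi_civita A (deformed_metric a) D'"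
begin

lemma metric': "riemannian_metric A (deformed_metric a)"
  by (rule riemannian_deformed_metric[OF a_pos])

lemma connection'_eq:
  assumes "X \<in> vector_fields A" "Y \<in> vector_fields A"
  shows "D' X Y p = D X Y p + ((a - 1) / a * horizontal_metric p (X p) (Y p)) *\<^sub>R \<xi> p"
  using levi_civita_unique[OF metric' levi_civita' levi_civita_deformed[OF a_pos] assms]
  by (simp add: deformed_connection_def)

lemma horizontal_metric_xi: "u \<in> tangent_space A p \<Longrightarrow> horizontal_metric p u (\<xi> p) = 0"
  by (simp add: horizontal_metric_def metric_xi_right)

text \<open>
  Since \<open>\<phi> \<xi> = 0\<close>, the correction of the connection enters only through \<open>D'\<^sub>X (\<phi> Y)\<close>. There it subtracts
  \<open>(a - 1) / a\<close> times \<open>g(\<phi> X, Y) \<xi>\<close>, by the skew symmetry of \<open>\<phi>\<close>, so that \<open>1 / a\<close> of this term is left.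
\<close>

lemma cov_deriv_phi':
  assumes X: "X \<in> vector_fields A" and Y: "Y \<in> vector_fields A"
  shows "cov_deriv_endo D' \<phi> X Y =
    (1 / a) *\<^sub>R (eval2 g (eval_endo \<phi> X) Y \<cdot>\<^sub>F \<xi>) - eval1 \<eta> Y \<cdot>\<^sub>F eval_endo \<phi> X"
proof
  fix p
  have DXY: "D X Y \<in> vector_fields A"
    by (rule connection_closed[OF levi_civita_affine[OF levi_civita] X Y])
  define k where "k = g p (\<phi> p (X p)) (Y p)"
  have "D' X (\<lambda>q. \<phi> q (Y q)) p = D X (\<lambda>q. \<phi> q (Y q)) p - ((a - 1) / a * k) *\<^sub>R \<xi> p"
    using connection'_eq[OF X phi_vector_field[OF Y]] X Y
    by (simp add: eval_endo_def horizontal_metric_def metric_phi_skew eta_phi k_def)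
  moreover have "\<phi> p (D' X Y p) = \<phi> p (D X Y p)"
    using DXY by (simp add: connection'_eq[OF X Y] phi_linear)
  ultimately have "cov_deriv_endo D' \<phi> X Y p =
      (k *\<^sub>R \<xi> p - ((a - 1) / a * k) *\<^sub>R \<xi> p) - \<eta> p (Y p) *\<^sub>R \<phi> p (X p)"
    by (simp add: cov_deriv_endo_def eval_endo_def connection_phi[OF X Y] k_def)
  moreover have "k - (a - 1) / a * k = 1 / a * k"
    using a_pos by (simp add: field_simps)
  ultimately show "cov_deriv_endo D' \<phi> X Y p =
    ((1 / a) *\<^sub>R (eval2 g (eval_endo \<phi> X) Y \<cdot>\<^sub>F \<xi>) - eval1 \<eta> Y \<cdot>\<^sub>F eval_endo \<phi> X) p"
    by (simp add: eval_endo_def eval1_def eval2_def k_def flip: scaleR_left_diff_distrib)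
qed

lemma connection'_xi:
  assumes X: "X \<in> vector_fields A"
  shows "D' X ((1 / a) *\<^sub>R \<xi>) p = (1 / a) *\<^sub>R (X p - \<eta> p (X p) *\<^sub>R \<xi> p)"
  using X by (simp add: connection_scaleR_right[OF levi_civita_affine[OF levi_civita'] X]
      connection'_eq connection_xi horizontal_metric_xi)

text \<open>
  For a torsion-free metric connection, \<open>(L\<^sub>Z g')(X,Y) = g'(D'\<^sub>X Z, Y) + g'(X, D'\<^sub>Y Z)\<close>. With
  \<open>Z = \<xi> / a\<close> the covariant derivatives on the right are \<open>1 / a\<close> times the horizontal parts of \<open>X\<close> and \<open>Y\<close>,
  on which the deformed metric is \<open>a\<close> times \<open>g\<close>.
\<close>

lemma lie_derivative':
  assumes X: "X \<in> vector_fields A" and Y: "Y \<in> vector_fields A"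
  shows "lie_derivative_2 ((1 / a) *\<^sub>R \<xi>) (deformed_metric a) X Y p
    = 2 * (eval2 g X Y p - eval1 \<eta> X p * eval1 \<eta> Y p)"
proof -
  let ?Z = "(1 / a) *\<^sub>R \<xi>" and ?g = "deformed_metric a"
  have Z: "?Z \<in> vector_fields A" by (intro vector_fields_scaleR xi_vector_field)
  note closed = connection_closed[OF levi_civita_affine[OF levi_civita']]
  have br: "bracket ?Z W p = D' ?Z W p - (1 / a) *\<^sub>R (W p - \<eta> p (W p) *\<^sub>R \<xi> p)"
    if "W \<in> vector_fields A" for W
    using levi_civita_torsion[OF levi_civita' Z that] connection'_xi[OF that, of p]
    by (metis fun_diff_def)
  have "lie_derivative_2 ?Z ?g X Y p =
    ?g p (D' ?Z X p) (Y p) + ?g p (X p) (D' ?Z Y p)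
    - ?g p (bracket ?Z X p) (Y p) - ?g p (X p) (bracket ?Z Y p)"
    using levi_civita_metric[OF levi_civita' Z X Y, of p]
    by (simp add: lie_derivative_2_def app_def eval2_def)
  also have "\<dots> = ?g p ((1 / a) *\<^sub>R (X p - \<eta> p (X p) *\<^sub>R \<xi> p)) (Y p)
      + ?g p (X p) ((1 / a) *\<^sub>R (Y p - \<eta> p (Y p) *\<^sub>R \<xi> p))"
    using X Y closed[OF Z X] closed[OF Z Y]
    by (simp add: br metric_simps(2,6)[OF metric'])
  also have "\<dots> = 2 * (g p (X p) (Y p) - \<eta> p (X p) * \<eta> p (Y p))"
    using X Y a_pos
    by (simp add: deformed_metric_def g_linear eta_linear metric_xi_left metric_xi_right field_simps)
  finally show ?thesis by (simp add: eval1_def eval2_def)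
qed

text \<open>
  The endomorphism \<open>V \<mapsto> D\<^sub>V \<xi>\<close> is the projection \<open>I - \<eta> \<otimes> \<xi>\<close> onto the kernel of \<open>\<eta>\<close>.
\<close>

lemma divergence_xi: "divergence A D \<xi> p = real CARD('m) - 1"
proof -
  obtain C where C: "finite C" "independent C" "span C = tangent_space A p" "card C = CARD('m)"
    by (rule tangent_space_basis)
  have eta: "linear_map_on (tangent_space A p) (\<lambda>v. - \<eta> p v)"
    by (simp add: linear_map_on_def eta_linear)
  have "divergence A D \<xi> p = trace_on (tangent_space A p) (\<lambda>v. v + (- \<eta> p v) *\<^sub>R \<xi> p)"
    by (rule divergence_rule) (simp add: connection_xi)
  also have "\<dots> = real CARD('m) - 1"
    using trace_on_rank_one[OF C(1-3) eta, of "\<xi> p"]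
    by (subst trace_on_add[OF C(1-3)]) (simp_all add: trace_on_id[OF C(1-3)] C(4))
  finally show ?thesis .
qed

text \<open>
  As a function of \<open>V\<close>, the correction \<open>(a - 1) / a h(V,X) \<xi>\<close> has rank one, and its trace is a multiple
  of \<open>h(\<xi>,X) = 0\<close>.
\<close>

lemma divergence'_eq:
  assumes X: "X \<in> vector_fields A"
  shows "divergence A D' X = divergence A D X"
proof
  fix p
  obtain C where C: "finite C" "independent C" "span C = tangent_space A p"
    by (rule tangent_space_basis)
  have h: "linear_map_on (tangent_space A p) (\<lambda>v. c * horizontal_metric p v (X p))" for c
    using X by (simp add: linear_map_on_def horizontal_metric_def g_linear eta_linear algebra_simps)
  have "horizontal_metric p (\<xi> p) (X p) = 0"
    using X horizontal_metric_xi horizontal_metric_sym[of "\<xi> p" p "X p"] by simp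
  moreover have "cov_deriv_at A D' X p v
      = cov_deriv_at A D X p v + ((a - 1) / a * horizontal_metric p v (X p)) *\<^sub>R \<xi> p"
    if "v \<in> tangent_space A p" for v
    using cov_deriv_at_extension[OF that] connection'_eq[OF _ X] by metis
  then have "divergence A D' X p = trace_on (tangent_space A p)
      (\<lambda>v. cov_deriv_at A D X p v + ((a - 1) / a * horizontal_metric p v (X p)) *\<^sub>R \<xi> p)"
    unfolding divergence_def by (rule trace_on_cong[OF C])
  moreover have "\<dots> = divergence A D X p + (a - 1) / a * horizontal_metric p (\<xi> p) (X p)"
    using trace_on_rank_one[OF C h, of "\<xi> p" "(a - 1) / a"]
    by (subst trace_on_add[OF C])
      (simp_all add: cov_deriv_at_tangent[OF levi_civita_affine[OF levi_civita] X] divergence_def)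
  ultimately show "divergence A D' X p = divergence A D X p" by simp
qed

lemma hessian'_eq:
  assumes "X \<in> vector_fields A" "Y \<in> vector_fields A"
  shows "hessian D' f X Y p = hessian D f X Y p
    - (a - 1) / a * app \<xi> f p * (eval2 g X Y p - eval1 \<eta> X p * eval1 \<eta> Y p)"
  using assms
  by (simp add: hessian_def app_def connection'_eq horizontal_metric_def eval1_def eval2_def)

text \<open>
  The vector on the right represents \<open>w \<mapsto> w(f)\<close> with respect to the deformed metric: as
  \<open>\<eta>(grad f) = \<xi>(f)\<close>, its first summand contributes the additional term \<open>(a - 1) \<xi>(f) \<eta>(w)\<close>, and the second
  one cancels it because \<open>\<xi>\<close> pairs with \<open>w\<close> to \<open>a\<^sup>2 \<eta>(w)\<close>.
\<close>

lemma gradient'_eq: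
  "gradient A (deformed_metric a) f
    = (1 / a) *\<^sub>R gradient A g f - ((a - 1) / a\<^sup>2) *\<^sub>R (app \<xi> f \<cdot>\<^sub>F \<xi>)"
proof
  fix p
  let ?v = "gradient A g f p"
  note T = gradient_tangent[OF metric, of f p]
  have eta: "\<eta> p ?v = \<xi> p f"
    using gradient_rep[OF metric, of "\<xi> p" p f] T by (simp add: metric_xi_right)
  have "gradient A (deformed_metric a) f p = (1 / a) *\<^sub>R ?v - ((a - 1) / a\<^sup>2 * \<xi> p f) *\<^sub>R \<xi> p"
  proof (rule gradient_eqI[OF metric'])
    fix w assume w: "w \<in> tangent_space A p"
    have "g p ?v w = w f" by (rule gradient_rep[OF metric w])
    then show "deformed_metric a p ((1 / a) *\<^sub>R ?v - ((a - 1) / a\<^sup>2 * \<xi> p f) *\<^sub>R \<xi> p) w = w f"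
      using T w a_pos
      by (simp add: deformed_metric_def g_linear eta_linear metric_xi_left eta)
        (simp add: field_simps power2_eq_square)
  qed (use T in simp)
  then show "gradient A (deformed_metric a) f p
      = ((1 / a) *\<^sub>R gradient A g f - ((a - 1) / a\<^sup>2) *\<^sub>R (app \<xi> f \<cdot>\<^sub>F \<xi>)) p"
    by (simp add: app_def)
qed

text \<open>
  The divergence is unchanged, so it remains to take the divergence of the formula for the gradient;
  the Leibniz rule gives \<open>div(\<xi>(f) \<xi>) = \<xi>(\<xi>(f)) + \<xi>(f) div \<xi>\<close>.
\<close>

lemma laplacian'_eq:
  assumes f: "f \<in> smooth_functions A"
  shows "laplacian A (deformed_metric a) D' f p = (1 / a) * laplacian A g D f p
    - (real CARD('m) - 1) * (a - 1) / a\<^sup>2 * app \<xi> f p - (a - 1) / a\<^sup>2 * app \<xi> (app \<xi> f) p"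
proof -
  note affine = levi_civita_affine[OF levi_civita]
  have xif: "app \<xi> f \<in> smooth_functions A"
    unfolding app_def by (rule vector_fields_smooth[OF xi_vector_field f])
  note grad = vector_fields_gradient[OF metric f]
  note h = vector_fields_fmult[OF xif xi_vector_field]
  let ?c = "(a - 1) / a\<^sup>2"
  have "laplacian A (deformed_metric a) D' f p
      = divergence A D (gradient A (deformed_metric a) f) p"
    unfolding laplacian_def
    by (simp add: divergence'_eq[OF vector_fields_gradient[OF metric' f]])
  also have "gradient A (deformed_metric a) f
      = (1 / a) *\<^sub>R gradient A g f + (- ?c) *\<^sub>R (app \<xi> f \<cdot>\<^sub>F \<xi>)"
    by (simp add: gradient'_eq)
  also have "divergence A D \<dots> p = (1 / a) * laplacian A g D f p
      + (- ?c) * (app \<xi> (app \<xi> f) p + app \<xi> f p * (real CARD('m) - 1))"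
    unfolding divergence_add[OF affine vector_fields_scaleR[OF grad] vector_fields_scaleR[OF h]]
      divergence_scaleR[OF affine grad] divergence_scaleR[OF affine h]
      divergence_fmult[OF affine xi_vector_field xif] divergence_xi laplacian_def
    by (simp add: app_def)
  finally show ?thesis by (simp add: algebra_simps diff_divide_distrib add_divide_distrib)
qed

end

theorem proposition2p1:
  fixes A :: "('p::{t2_space, second_countable_topology}, 'm::finite) atlas"
    and \<phi> \<phi>' :: "'p endo" and \<xi> \<xi>' :: "'p vfield" and \<eta> \<eta>' :: "'p one_form"
    and g g' :: "'p two_tensor" and D D' :: "'p connection"
    and n :: nat and a :: real
  assumes "n \<ge> 1" and "CARD('m) = 2 * n + 1"
    and "kenmotsu A \<phi> \<xi> \<eta> g D"
    and "a > 0"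
    and "(\<phi>', \<xi>', \<eta>', g') = D_homothetic a (\<phi>, \<xi>, \<eta>, g)"
    and "levi_civita A g' D'"
  shows
    "(\<forall>X\<in>vector_fields A. \<forall>Y\<in>vector_fields A.
        cov_deriv_endo D' \<phi>' X Y =
          (1 / a) *\<^sub>R (eval2 g (eval_endo \<phi> X) Y \<cdot>\<^sub>F \<xi>) - eval1 \<eta> Y \<cdot>\<^sub>F eval_endo \<phi> X) \<and>
     (\<forall>X\<in>vector_fields A. D' X \<xi>' = (1 / a) *\<^sub>R (X - eval1 \<eta> X \<cdot>\<^sub>F \<xi>)) \<and>
     (\<forall>X\<in>vector_fields A. \<forall>Y\<in>vector_fields A. \<forall>p.
        lie_derivative_2 \<xi>' g' X Y p = 2 * (eval2 g X Y p - eval1 \<eta> X p * eval1 \<eta> Y p)) \<and>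
     (\<forall>p. divergence A D' \<xi>' p = 2 * real n / a) \<and>
     (\<forall>f\<in>smooth_functions A. \<forall>X\<in>vector_fields A. \<forall>Y\<in>vector_fields A. \<forall>p.
        hessian D' f X Y p = hessian D f X Y p
          - (a - 1) / a * app \<xi> f p * (eval2 g X Y p - eval1 \<eta> X p * eval1 \<eta> Y p)) \<and>
     (\<forall>f\<in>smooth_functions A.
        gradient A g' f = (1 / a) *\<^sub>R gradient A g f - ((a - 1) / a\<^sup>2) *\<^sub>R (app \<xi> f \<cdot>\<^sub>F \<xi>)) \<and>
     (\<forall>X\<in>vector_fields A. divergence A D' X = divergence A D X) \<and>
     (\<forall>f\<in>smooth_functions A. \<forall>p.
        laplacian A g' D' f p = (1 / a) * laplacian A g D f p
          - 2 * real n * (a - 1) / a\<^sup>2 * app \<xi> f p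
          - (a - 1) / a\<^sup>2 * app \<xi> (app \<xi> f) p)"
proof -
  interpret kenmotsu_manifold A \<phi> \<xi> \<eta> g D
    by unfold_locales
      (use assms(3) in \<open>simp_all add: kenmotsu_def almost_contact_metric_def\<close>)
  have deformed: "\<phi>' = \<phi>" "\<xi>' = (1 / a) *\<^sub>R \<xi>" "g' = deformed_metric a"
    using assms(5) by (simp_all add: D_homothetic_def deformed_metric_def)
  interpret deformed_kenmotsu_manifold A \<phi> \<xi> \<eta> g D a D'
    by unfold_locales (use assms(4,6) deformed in simp_all)
  have dim: "real CARD('m) - 1 = 2 * real n" using assms(2) by simp
  have "D' X \<xi>' = (1 / a) *\<^sub>R (X - eval1 \<eta> X \<cdot>\<^sub>F \<xi>)" if "X \<in> vector_fields A" for X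
    using connection'_xi[OF that]
    by (intro ext[of "_ :: 'p vfield"]) (simp add: deformed(2) eval1_def)
  moreover have "divergence A D' \<xi>' p = 2 * real n / a" for p
    using divergence_xi[of p] dim levi_civita_affine[OF levi_civita]
    by (simp add: deformed(2) divergence'_eq vector_fields_scaleR divergence_scaleR)
  ultimately show ?thesis
    unfolding deformed(1,3)
    using cov_deriv_phi' lie_derivative' hessian'_eq gradient'_eq divergence'_eq laplacian'_eq
    unfolding dim deformed(2)[symmetric] by blast
qed

end
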